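(* Let $A\subset\mathbb Z^k$ be a finite set. If $A$ is not contained in a union of two parallel affine hyperplanes of $\mathbb R^k$, then $A$ is not dual defect.
   Context: $\mathbb C[A]$ is the space of Laurent polynomials $\sum_{a\in A}c_ay^a$ on $(\mathbb C\setminus0)^k$, and $\Sigma_A\subset\mathbb C[A]$ is the set of all $\varphi$ such that $\varphi(y)=0$ and $d\varphi(y)=0$ for some $y\in(\mathbb C\setminus0)^k$. The set $A$ is dual defect if the closure of $\Sigma_A$ is not a hypersurface in $\mathbb C[A]$ (equivalently, the $A$-discriminant is $1$). *)

theory Defs
  imports "HOL-Analysis.Analysis" "HOL-Library.Poly_Mapping"
begin

text \<open>
  A Laurent polynomial in \<open>k = CARD('k)\<close> variables is a finitely supported map from exponents
  in \<open>int ^ 'k\<close> to coefficients; the product of \<^typ>\<open>(int ^ 'k) \<Rightarrow>\<^sub>0 complex\<close> is convolution.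
\<close>

type_synonym 'k laurent = "(int ^ 'k) \<Rightarrow>\<^sub>0 complex"

definition laurent_eval :: "'k::finite laurent \<Rightarrow> complex ^ 'k \<Rightarrow> complex" where
  "laurent_eval \<phi> y =
     (\<Sum>a\<in>Poly_Mapping.keys \<phi>. Poly_Mapping.lookup \<phi> a * (\<Prod>i\<in>UNIV. (y $ i) powi (a $ i)))"

definition laurent_space :: "(int ^ 'k) set \<Rightarrow> 'k::finite laurent set" where
  "laurent_space A = {\<phi>. Poly_Mapping.keys \<phi> \<subseteq> A}"

definition torus :: "(complex ^ 'k::finite) set" where
  "torus = {y. \<forall>i. y $ i \<noteq> 0}"

text \<open>
  Laurent polynomials are holomorphic on the torus, so their real Frechet derivative there, which
  is what \<^const>\<open>has_derivative\<close> speaks about, is the complex differential.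
\<close>

definition Sigma_set :: "(int ^ 'k) set \<Rightarrow> 'k::finite laurent set" where
  "Sigma_set A = {\<phi> \<in> laurent_space A. \<exists>y\<in>torus.
     laurent_eval \<phi> y = 0 \<and> (laurent_eval \<phi> has_derivative (\<lambda>_. 0)) (at y)}"

text \<open>
  Polynomial functions on the space of Laurent polynomials supported in \<open>A\<close> are polynomials in
  the coefficients, that is, in variables indexed by \<open>A\<close>. The inner finitely supported map is the
  exponent of a monomial in these variables.
\<close>

type_synonym 'x mpoly = "('x \<Rightarrow>\<^sub>0 nat) \<Rightarrow>\<^sub>0 complex"

definition polys_in :: "'x set \<Rightarrow> 'x mpoly set" where
  "polys_in X = {p. \<forall>m\<in>Poly_Mapping.keys p. Poly_Mapping.keys m \<subseteq> X}"

definition mpoly_eval :: "'x mpoly \<Rightarrow> ('x \<Rightarrow> complex) \<Rightarrow> complex" where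
  "mpoly_eval p c =
     (\<Sum>m\<in>Poly_Mapping.keys p. Poly_Mapping.lookup p m *
        (\<Prod>x\<in>Poly_Mapping.keys m. c x ^ Poly_Mapping.lookup m x))"

definition zero_locus :: "(int ^ 'k) set \<Rightarrow> (int ^ 'k) mpoly \<Rightarrow> 'k::finite laurent set" where
  "zero_locus A p = {\<phi> \<in> laurent_space A. mpoly_eval p (Poly_Mapping.lookup \<phi>) = 0}"

text \<open>
  The Zariski closure. On \<^const>\<open>Sigma_set\<close>, which is constructible, it agrees with the closure
  in the Euclidean topology.
\<close>

definition zariski_closure :: "(int ^ 'k) set \<Rightarrow> 'k laurent set \<Rightarrow> 'k::finite laurent set" where
  "zariski_closure A S =
     {\<phi> \<in> laurent_space A. \<forall>p\<in>polys_in A. S \<subseteq> zero_locus A p \<longrightarrow> \<phi> \<in> zero_locus A p}"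

definition hypersurface :: "(int ^ 'k) set \<Rightarrow> 'k::finite laurent set \<Rightarrow> bool" where
  "hypersurface A V \<longleftrightarrow>
     (\<exists>p\<in>polys_in A. (\<exists>m\<in>Poly_Mapping.keys p. m \<noteq> 0) \<and> V = zero_locus A p)"

definition dual_defect :: "(int ^ 'k::finite) set \<Rightarrow> bool" where
  "dual_defect A \<longleftrightarrow> \<not> hypersurface A (zariski_closure A (Sigma_set A))"

definition affine_hyperplane :: "(real ^ 'k::finite) set \<Rightarrow> bool" where
  "affine_hyperplane H \<longleftrightarrow> (\<exists>n b. n \<noteq> 0 \<and> H = {x. n \<bullet> x = b})"

definition real_point :: "int ^ 'k::finite \<Rightarrow> real ^ 'k" where
  "real_point a = (\<chi> i. real_of_int (a $ i))"

end

theory Submission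
  imports Defs "HOL-Complex_Analysis.Conformal_Mappings" "HOL-Library.Function_Algebras"
    "HOL-Computational_Algebra.Polynomial_Factorial" "HOL-Computational_Algebra.Field_as_Ring"
begin

text \<open>
  In logarithmic coordinates the coefficient vectors of singular Laurent polynomials are
  \<open>w\<^sub>a exp(a \<cdot> x)\<close>, where \<open>w\<close> is an affine relation of \<open>A\<close>. The Hessian at the singular point
  is \<open>\<Sum>\<^sub>a w\<^sub>a a a\<^sup>T\<close>. If \<open>A\<close> is not contained in two parallel hyperplanes, some \<open>w\<close> makes it
  nondegenerate: contract a minimal affinely dependent subset of \<open>A\<close> and induct on the dimension;
  an affinely independent set would lie in two parallel hyperplanes.

  The ideal of \<open>\<Sigma>\<^sub>A\<close> is prime because the parametrization is by a vector space, and it is nonzero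
  by counting monomials. Where the Hessian is nondegenerate, the normal direction of \<open>\<Sigma>\<^sub>A\<close> is the
  vector \<open>(y\<^sup>a)\<^sub>a\<close>. Hence for a generic direction \<open>w0\<close> no nonzero element of the ideal is
  constant along \<open>w0\<close>, that is, \<open>\<Sigma>\<^sub>A\<close> has codimension one, and the ideal is principal by Gauss' lemma.
\<close>

text \<open>The obstacle is principality. If the prime ideal meets \<open>R\<close> only in zero, it
  is generated over the fraction field of \<open>R\<close> by one polynomial in \<open>T\<close> of
  least degree; removing denominators would normally use unique factorization in several variables.
  Here it is used only for polynomials in \<open>T\<close> over the polynomials in one variable
  \<open>s\<close>: on complex lines the leading coefficient divides the other coefficients, and the
  quotients on the lines through one point assemble to a polynomial. Gauss' lemma needs an element
  of the ideal that is monic in \<open>T\<close>. It comes from a homogeneous equation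
  \<open>h\<close> of the cone of singular coefficient vectors, since \<open>h (c + t * w0)\<close>
  has leading coefficient \<open>h w0\<close> in \<open>t\<close>. So genericity of
  \<open>w0\<close> means two inequalities: \<open>h w0\<close> is nonzero, and so is the sum of the
  coefficients of \<open>w0\<close>, its value at (1, ..., 1). Once the ideal is principal, the
  closure is by definition the zero locus of the generator.\<close>

hide_const (open) Poly_Mapping.degree Poly_Mapping.map

section \<open>Polynomial functions\<close>

text \<open>Polynomials are represented by their functions, which loses nothing over an infinite
  field and makes substitution and restriction to lines immediate. Arguments range over the whole
  type, but only coordinates in \<open>A\<close> matter.\<close>

inductive_set polyfun :: "'x set \<Rightarrow> (('x \<Rightarrow> complex) \<Rightarrow> complex) set" for A where
  polyfun_const: "(\<lambda>_. k) \<in> polyfun A"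
| polyfun_var: "a \<in> A \<Longrightarrow> (\<lambda>c. c a) \<in> polyfun A"
| polyfun_add: "f \<in> polyfun A \<Longrightarrow> g \<in> polyfun A \<Longrightarrow> (\<lambda>c. f c + g c) \<in> polyfun A"
| polyfun_mult: "f \<in> polyfun A \<Longrightarrow> g \<in> polyfun A \<Longrightarrow> (\<lambda>c. f c * g c) \<in> polyfun A"

lemma polyfun_diff: "f \<in> polyfun A \<Longrightarrow> g \<in> polyfun A \<Longrightarrow> (\<lambda>c. f c - g c) \<in> polyfun A"
  using polyfun_add[OF _ polyfun_mult[OF polyfun_const[of "-1"]], of f A g] by simp

lemma polyfun_power: "f \<in> polyfun A \<Longrightarrow> (\<lambda>c. f c ^ n) \<in> polyfun A"
  by (induction n) (auto intro: polyfun_const polyfun_mult)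

lemma polyfun_sum: "(\<And>i. i \<in> S \<Longrightarrow> f i \<in> polyfun A) \<Longrightarrow> (\<lambda>c. \<Sum>i\<in>S. f i c) \<in> polyfun A"
  by (induction S rule: infinite_finite_induct) (auto intro: polyfun_const polyfun_add)

lemma polyfun_prod: "(\<And>i. i \<in> S \<Longrightarrow> f i \<in> polyfun A) \<Longrightarrow> (\<lambda>c. \<Prod>i\<in>S. f i c) \<in> polyfun A"
  by (induction S rule: infinite_finite_induct) (auto intro: polyfun_const polyfun_mult)

lemma polyfun_cong:
  "f \<in> polyfun A \<Longrightarrow> (\<And>a. a \<in> A \<Longrightarrow> c a = d a) \<Longrightarrow> f c = f d"
  by (induction rule: polyfun.induct) auto

lemma polyfun_subst:
  "f \<in> polyfun A \<Longrightarrow> (\<And>a. a \<in> A \<Longrightarrow> h a \<in> polyfun B) \<Longrightarrow> (\<lambda>c. f (\<lambda>a. h a c)) \<in> polyfun B"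
  by (induction rule: polyfun.induct) (auto intro: polyfun.intros)

lemma polyfun_plus: "f \<in> polyfun A \<Longrightarrow> g \<in> polyfun A \<Longrightarrow> f + g \<in> polyfun A"
  by (drule (1) polyfun_add) (simp add: plus_fun_def)

lemma polyfun_times: "f \<in> polyfun A \<Longrightarrow> g \<in> polyfun A \<Longrightarrow> f * g \<in> polyfun A"
  by (drule (1) polyfun_mult) (simp add: times_fun_def)

lemma polyfun_minus: "f \<in> polyfun A \<Longrightarrow> g \<in> polyfun A \<Longrightarrow> f - g \<in> polyfun A"
  by (drule (1) polyfun_diff) (simp add: fun_diff_def)

lemma polyfun_zero: "0 \<in> polyfun A" and polyfun_one: "1 \<in> polyfun A"
  using polyfun_const[of 0 A] polyfun_const[of 1 A] by (simp_all add: zero_fun_def one_fun_def)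

lemma polyfun_sum': "(\<And>i. i \<in> S \<Longrightarrow> f i \<in> polyfun A) \<Longrightarrow> (\<Sum>i\<in>S. f i) \<in> polyfun A"
  by (induction S rule: infinite_finite_induct) (auto intro: polyfun_zero polyfun_plus)

section \<open>Polynomials in one variable over a ring of functions\<close>

definition polys_over :: "'a set \<Rightarrow> 'a::zero poly set" where
  "polys_over R = {P. \<forall>i. coeff P i \<in> R}"

text \<open>Base point and direction may depend polynomially on a parameter \<open>c\<close>, so
  that one expansion serves the lines through a fixed point, the shift along a fixed vector and
  scaling. The variable \<open>t\<close> enters as a constant function because the coefficients of
  \<open>P\<close> are functions of \<open>c\<close>.\<close>

lemma polyfun_expand:
  assumes "f \<in> polyfun A" "\<And>a. a \<in> A \<Longrightarrow> \<alpha> a \<in> polyfun B" "\<And>a. a \<in> A \<Longrightarrow> \<beta> a \<in> polyfun B"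
  obtains P where "P \<in> polys_over (polyfun B)"
    "\<And>c t. f (\<lambda>a. \<alpha> a c + t * \<beta> a c) = poly P (\<lambda>_. t) c"
proof -
  have "\<exists>P\<in>polys_over (polyfun B). \<forall>c t. f (\<lambda>a. \<alpha> a c + t * \<beta> a c) = poly P (\<lambda>_. t) c"
    using assms
  proof (induction rule: polyfun.induct)
    case (polyfun_const k)
    show ?case
      by (rule bexI[of _ "[:\<lambda>_. k:]"])
        (auto simp: polys_over_def coeff_pCons split: nat.split intro: polyfun.polyfun_const polyfun_zero)
  next
    case (polyfun_var a)
    then show ?case
      by (intro bexI[of _ "[:\<alpha> a, \<beta> a:]"])
        (auto simp: polys_over_def coeff_pCons split: nat.split intro: polyfun_zero)
  next
    case (polyfun_add f g)
    then obtain P Q where "P \<in> polys_over (polyfun B)" "Q \<in> polys_over (polyfun B)"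
      "\<forall>c t. f (\<lambda>a. \<alpha> a c + t * \<beta> a c) = poly P (\<lambda>_. t) c"
      "\<forall>c t. g (\<lambda>a. \<alpha> a c + t * \<beta> a c) = poly Q (\<lambda>_. t) c" by blast
    then show ?case
      by (intro bexI[of _ "P + Q"]) (auto simp: polys_over_def intro: polyfun_plus)
  next
    case (polyfun_mult f g)
    then obtain P Q where "P \<in> polys_over (polyfun B)" "Q \<in> polys_over (polyfun B)"
      "\<forall>c t. f (\<lambda>a. \<alpha> a c + t * \<beta> a c) = poly P (\<lambda>_. t) c"
      "\<forall>c t. g (\<lambda>a. \<alpha> a c + t * \<beta> a c) = poly Q (\<lambda>_. t) c" by blast
    then show ?case
      by (intro bexI[of _ "P * Q"])
        (auto simp: polys_over_def coeff_mult intro!: polyfun_sum' polyfun_times)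
  qed
  then show ?thesis using that by blast
qed

lemma poly_fun_apply: "poly P F c = (\<Sum>i\<le>degree P. coeff P i c * F c ^ i)"
  for P :: "('a \<Rightarrow> complex) poly"
proof -
  have p: "(G ^ i) c = G c ^ i" for G :: "'a \<Rightarrow> complex" and i
    by (induction i) auto
  have s: "(\<Sum>i\<in>S. H i) c = (\<Sum>i\<in>S. H i c)" for H :: "nat \<Rightarrow> 'a \<Rightarrow> complex" and S
    by (induction S rule: infinite_finite_induct) auto
  show ?thesis by (simp add: poly_altdef s p)
qed

text \<open>Fixing the argument passes from a coefficient ring with zero divisors to a field; the
  degree may drop.\<close>

definition eval_coeffs :: "('a \<Rightarrow> complex) poly \<Rightarrow> 'a \<Rightarrow> complex poly" where
  "eval_coeffs P c = map_poly (\<lambda>f. f c) P"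

lemma coeff_eval_coeffs [simp]: "coeff (eval_coeffs P c) i = coeff P i c"
  by (simp add: eval_coeffs_def coeff_map_poly)

lemma poly_eval_coeffs: "poly (eval_coeffs P c) (F c) = poly P F c"
proof -
  have "degree (eval_coeffs P c) \<le> degree P" by (rule degree_le) (simp add: coeff_eq_0)
  then have "poly (eval_coeffs P c) (F c) = (\<Sum>i\<le>degree P. coeff (eval_coeffs P c) i * F c ^ i)"
    unfolding poly_altdef
    by (intro sum.mono_neutral_left) (auto simp: coeff_eq_0 simp flip: coeff_eval_coeffs)
  then show ?thesis by (simp add: poly_fun_apply)
qed

lemma polyfun_line:
  assumes "f \<in> polyfun A"
  obtains q where "\<And>s. f (\<lambda>a. b a + s * e a) = poly q s"
proof -
  obtain P where "\<And>c t. f (\<lambda>a. b a + t * e a) = poly P (\<lambda>_. t) (c::'a \<Rightarrow> complex)"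
    using polyfun_expand[of f A "\<lambda>a _. b a" A "\<lambda>a _. e a"] assms polyfun_const by metis
  then have "f (\<lambda>a. b a + s * e a) = poly (eval_coeffs P b) s" for s
    using poly_eval_coeffs[of P b "\<lambda>_. s"] by simp
  then show ?thesis using that by blast
qed

text \<open>On the line joining a point where \<open>f\<close> is nonzero to one where
  \<open>g\<close> is nonzero, both restrict to nonzero polynomials in one variable.\<close>

lemma polyfun_no_zero_divisors:
  assumes "f \<in> polyfun A" "g \<in> polyfun A" "f * g = 0"
  shows "f = 0 \<or> g = 0"
proof (rule ccontr)
  assume "\<not> ?thesis"
  then obtain c d where cd: "f c \<noteq> 0" "g d \<noteq> 0" by (auto simp: fun_eq_iff)
  obtain p where p: "\<And>s. f (\<lambda>a. c a + s * (d a - c a)) = poly p s"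
    using polyfun_line[OF assms(1), of c "\<lambda>a. d a - c a"] by blast
  obtain q where q: "\<And>s. g (\<lambda>a. c a + s * (d a - c a)) = poly q s"
    using polyfun_line[OF assms(2), of c "\<lambda>a. d a - c a"] by blast
  have "poly (p * q) s = 0" for s
    using assms(3) p q by (metis poly_mult times_fun_apply zero_fun_apply)
  then have "p * q = 0" using poly_all_0_iff_0 by blast
  moreover have "poly p 0 \<noteq> 0" "poly q 1 \<noteq> 0" using cd p[of 0] q[of 1] by (auto simp flip: p q)
  ultimately show False by auto
qed

text \<open>The partial derivatives are specified by the chain rule along curves, which makes sense
  for an arbitrary index type and is the form in which they are used.\<close>

lemma polyfun_gradient:
  assumes "finite A" "f \<in> polyfun A"
  obtains G where "\<And>a. a \<in> A \<Longrightarrow> G a \<in> polyfun A"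
    "\<And>\<gamma> \<gamma>' s. (\<And>a. a \<in> A \<Longrightarrow> ((\<lambda>s. \<gamma> s a) has_field_derivative \<gamma>' a) (at s)) \<Longrightarrow>
       ((\<lambda>s. f (\<gamma> s)) has_field_derivative (\<Sum>a\<in>A. G a (\<gamma> s) * \<gamma>' a)) (at s)"
proof -
  have "\<exists>G. (\<forall>a\<in>A. G a \<in> polyfun A) \<and>
    (\<forall>\<gamma> \<gamma>' s. (\<forall>a\<in>A. ((\<lambda>s. \<gamma> s a) has_field_derivative \<gamma>' a) (at s)) \<longrightarrow>
       ((\<lambda>s. f (\<gamma> s)) has_field_derivative (\<Sum>a\<in>A. G a (\<gamma> s) * \<gamma>' a)) (at s))"
    using assms(2)
  proof (induction rule: polyfun.induct)
    case (polyfun_const k)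
    show ?case by (rule exI[of _ "\<lambda>_ _. 0"]) (auto intro: polyfun.polyfun_const)
  next
    case (polyfun_var b)
    have "(\<Sum>a\<in>A. (if a = b then 1 else 0) * \<gamma>' a) = \<gamma>' b" for \<gamma>' :: "'a \<Rightarrow> complex"
      using polyfun_var assms(1) by (simp add: if_distrib[of "\<lambda>x. x * _"] cong: if_cong)
    then show ?case using polyfun_var
      by (intro exI[of _ "\<lambda>a _. if a = b then 1 else 0"]) (auto intro: polyfun.polyfun_const)
  next
    case (polyfun_add f g)
    then obtain F G where
      "\<forall>a\<in>A. F a \<in> polyfun A" "\<forall>a\<in>A. G a \<in> polyfun A"
      "\<forall>\<gamma> \<gamma>' s. (\<forall>a\<in>A. ((\<lambda>s. \<gamma> s a) has_field_derivative \<gamma>' a) (at s)) \<longrightarrow>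
       ((\<lambda>s. f (\<gamma> s)) has_field_derivative (\<Sum>a\<in>A. F a (\<gamma> s) * \<gamma>' a)) (at s)"
      "\<forall>\<gamma> \<gamma>' s. (\<forall>a\<in>A. ((\<lambda>s. \<gamma> s a) has_field_derivative \<gamma>' a) (at s)) \<longrightarrow>
       ((\<lambda>s. g (\<gamma> s)) has_field_derivative (\<Sum>a\<in>A. G a (\<gamma> s) * \<gamma>' a)) (at s)" by blast
    then show ?case
      by (intro exI[of _ "\<lambda>a c. F a c + G a c"])
        (auto intro!: polyfun.polyfun_add DERIV_add simp: distrib_right sum.distrib)
  next
    case (polyfun_mult f g)
    then obtain F G where *:
      "\<forall>a\<in>A. F a \<in> polyfun A" "\<forall>a\<in>A. G a \<in> polyfun A"
      "\<forall>\<gamma> \<gamma>' s. (\<forall>a\<in>A. ((\<lambda>s. \<gamma> s a) has_field_derivative \<gamma>' a) (at s)) \<longrightarrow>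
       ((\<lambda>s. f (\<gamma> s)) has_field_derivative (\<Sum>a\<in>A. F a (\<gamma> s) * \<gamma>' a)) (at s)"
      "\<forall>\<gamma> \<gamma>' s. (\<forall>a\<in>A. ((\<lambda>s. \<gamma> s a) has_field_derivative \<gamma>' a) (at s)) \<longrightarrow>
       ((\<lambda>s. g (\<gamma> s)) has_field_derivative (\<Sum>a\<in>A. G a (\<gamma> s) * \<gamma>' a)) (at s)" by blast
    show ?case
    proof (intro exI[of _ "\<lambda>a c. F a c * g c + f c * G a c"] conjI ballI allI impI)
      show "(\<lambda>c. F a c * g c + f c * G a c) \<in> polyfun A" if "a \<in> A" for a
        using that * polyfun_mult by (auto intro!: polyfun.polyfun_add polyfun.polyfun_mult)
      fix \<gamma> :: "complex \<Rightarrow> 'a \<Rightarrow> complex" and \<gamma>' s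
      assume "\<forall>a\<in>A. ((\<lambda>s. \<gamma> s a) has_field_derivative \<gamma>' a) (at s)"
      then have "((\<lambda>s. f (\<gamma> s) * g (\<gamma> s)) has_field_derivative
        (\<Sum>a\<in>A. F a (\<gamma> s) * \<gamma>' a) * g (\<gamma> s) + (\<Sum>a\<in>A. G a (\<gamma> s) * \<gamma>' a) * f (\<gamma> s)) (at s)"
        using * by (intro DERIV_mult) auto
      then show "((\<lambda>s. f (\<gamma> s) * g (\<gamma> s)) has_field_derivative
        (\<Sum>a\<in>A. (F a (\<gamma> s) * g (\<gamma> s) + f (\<gamma> s) * G a (\<gamma> s)) * \<gamma>' a)) (at s)"
        by (simp add: sum_distrib_right sum_distrib_left sum.distrib algebra_simps)
    qed
  qed
  then show ?thesis using that by blast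
qed

lemma polyfun_holomorphic:
  assumes "f \<in> polyfun A" "\<And>a. a \<in> A \<Longrightarrow> (\<lambda>s. \<gamma> s a) holomorphic_on S"
  shows "(\<lambda>s. f (\<gamma> s)) holomorphic_on S"
  using assms by (induction rule: polyfun.induct) (auto intro!: holomorphic_intros)

text \<open>The quotient is found as a power series around a point \<open>b\<close> with \<open>l b \<noteq> 0\<close>: its
  homogeneous components are polynomials, and they vanish in large degree because they do so on
  every line through \<open>b\<close>.\<close>

lemma polyfun_dvd_if_dvd_on_lines:
  assumes l: "l \<in> polyfun A" and g: "g \<in> polyfun A" and "l b \<noteq> 0"
    and dvd: "\<And>e. \<exists>h. \<forall>s. g (\<lambda>a. b a + s * e a) = l (\<lambda>a. b a + s * e a) * poly h s"
  shows "\<exists>h\<in>polyfun A. g = l * h"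
proof -
  obtain L where L: "L \<in> polys_over (polyfun A)"
    "\<And>e s. l (\<lambda>a. b a + s * e a) = poly L (\<lambda>_. s) e"
    by (rule polyfun_expand[OF l, of "\<lambda>a _. b a" A "\<lambda>a e. e a"])
      (auto intro: polyfun_const polyfun_var)
  obtain G where G: "G \<in> polys_over (polyfun A)"
    "\<And>e s. g (\<lambda>a. b a + s * e a) = poly G (\<lambda>_. s) e"
    by (rule polyfun_expand[OF g, of "\<lambda>a _. b a" A "\<lambda>a e. e a"])
      (auto intro: polyfun_const polyfun_var)
  \<comment> \<open>The constant term in \<open>s\<close> is a nonzero number independent of
    \<open>e\<close>, so dividing by \<open>L\<close> as a power series only divides by
    numbers.\<close>
  have L0: "coeff L 0 e = l b" for e
    using L(2)[of 0 e] poly_eval_coeffs[of L e "\<lambda>_. 0"] by (simp add: poly_0_coeff_0)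
  have "\<exists>h. h \<in> polyfun A \<and> (\<forall>e q. eval_coeffs G e = eval_coeffs L e * q \<longrightarrow> h e = coeff q j)" for j
  proof (induction j rule: less_induct)
    case (less j)
    then obtain h where h: "\<And>i. i < j \<Longrightarrow> h i \<in> polyfun A"
      "\<And>i e q. i < j \<Longrightarrow> eval_coeffs G e = eval_coeffs L e * q \<Longrightarrow> h i e = coeff q i"
      by metis
    define k where "k e = (coeff G j e - (\<Sum>i\<in>{1..j}. coeff L i e * h (j - i) e)) * inverse (l b)" for e
    have "k \<in> polyfun A"
      unfolding k_def using L(1) G(1)
      by (intro polyfun_mult polyfun_diff polyfun_sum polyfun_const h) (auto simp: polys_over_def)
    moreover have "k e = coeff q j" if q: "eval_coeffs G e = eval_coeffs L e * q" for e q
    proof -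
      have "coeff G j e = (\<Sum>i\<le>j. coeff L i e * coeff q (j - i))"
        using arg_cong[OF q, of "\<lambda>p. coeff p j"] by (simp add: coeff_mult)
      also have "\<dots> = l b * coeff q j + (\<Sum>i\<in>{1..j}. coeff L i e * coeff q (j - i))"
      proof -
        have "{..j} = insert 0 {1..j}" by auto
        then show ?thesis by (simp add: L0)
      qed
      also have "(\<Sum>i\<in>{1..j}. coeff L i e * coeff q (j - i)) = (\<Sum>i\<in>{1..j}. coeff L i e * h (j - i) e)"
        by (intro sum.cong refl) (use h(2)[OF _ q] in auto)
      finally show ?thesis using assms(3) by (simp add: k_def)
    qed
    ultimately show ?case by blast
  qed
  then obtain h where h: "\<And>j. h j \<in> polyfun A"
    "\<And>j e q. eval_coeffs G e = eval_coeffs L e * q \<Longrightarrow> h j e = coeff q j" by metis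
  \<comment> \<open>Every quotient has degree at most \<open>degree G\<close>, so its value at
    \<open>s = 1\<close> is a sum whose range does not depend on \<open>e\<close>.\<close>
  define H where "H e = (\<Sum>j\<le>degree G. h j e)" for e
  have HA: "H \<in> polyfun A" unfolding H_def by (intro polyfun_sum h)
  have eq: "g (\<lambda>a. b a + e a) = l (\<lambda>a. b a + e a) * H e" for e
  proof -
    obtain q where q: "\<And>s. g (\<lambda>a. b a + s * e a) = l (\<lambda>a. b a + s * e a) * poly q s"
      using dvd by blast
    have "poly (eval_coeffs G e) s = poly (eval_coeffs L e * q) s" for s
      using q[of s] poly_eval_coeffs[of G e "\<lambda>_. s"] poly_eval_coeffs[of L e "\<lambda>_. s"] by (simp flip: L(2) G(2))
    then have Gq: "eval_coeffs G e = eval_coeffs L e * q" using poly_eq_poly_eq_iff by blast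
    have "degree q \<le> degree G"
    proof (cases "q = 0")
      case False
      moreover have "eval_coeffs L e \<noteq> 0"
        using L0[of e] assms(3) by (metis coeff_0 coeff_eval_coeffs)
      ultimately have "degree q \<le> degree (eval_coeffs G e)" by (simp add: Gq degree_mult_eq)
      also have "\<dots> \<le> degree G" by (rule degree_le) (simp add: coeff_eq_0)
      finally show ?thesis .
    qed simp
    then have "poly q 1 = H e"
      by (simp add: H_def h(2)[OF Gq] poly_altdef)
         (rule sum.mono_neutral_left, auto simp: coeff_eq_0)
    then show ?thesis using q[of 1] by simp
  qed
  have "g c = l c * H (\<lambda>a. c a - b a)" for c using eq[of "\<lambda>a. c a - b a"] by simp
  moreover have "(\<lambda>c. H (\<lambda>a. c a - b a)) \<in> polyfun A"
    by (rule polyfun_subst[OF HA]) (intro polyfun_diff polyfun_var polyfun_const)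
  ultimately show ?thesis by (intro bexI) (auto simp: fun_eq_iff)
qed

text \<open>A monic polynomial has content one, so by Gauss' lemma \<open>k\<close> and
  \<open>content P * content S\<close> agree up to units. Comparing leading coefficients shows that
  those of the primitive parts are units. Hence \<open>lead_coeff P\<close> is the content of
  \<open>P\<close> up to a unit.\<close>

lemma lead_coeff_dvd_if_dvd_monic:
  fixes P Q S :: "complex poly poly"
  assumes Q1: "lead_coeff Q = 1" and eq: "smult k Q = P * S" and k0: "k \<noteq> 0"
  shows "lead_coeff P dvd coeff P i"
proof -
  have Q: "Q \<noteq> 0" using Q1 by force
  have nz: "P \<noteq> 0" "S \<noteq> 0" using eq k0 Q by (auto simp: smult_eq_0_iff)
  define P' S' where "P' = primitive_part P" and "S' = primitive_part S"
  have P: "P = smult (content P) P'" and S: "S = smult (content S) S'" by (simp_all add: P'_def S'_def)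
  have "content Q dvd 1" using content_dvd_coeff[of Q "degree Q"] Q1 by simp
  then have "content Q = 1" by simp
  then have "normalize k = content P * content S"
    using arg_cong[OF eq, of content] by (simp add: content_mult)
  then have k: "k dvd content P * content S" "content P * content S dvd k"
    by (metis dvd_normalize_iff dvd_refl normalize_dvd_iff)+
  have lcP: "lead_coeff P = content P * lead_coeff P'"
    using arg_cong[OF P, of lead_coeff] by (simp only: lead_coeff_smult)
  have lcS: "lead_coeff S = content S * lead_coeff S'"
    using arg_cong[OF S, of lead_coeff] by (simp only: lead_coeff_smult)
  have "k * 1 = lead_coeff P * lead_coeff S"
    using arg_cong[OF eq, of lead_coeff] by (simp only: lead_coeff_smult lead_coeff_mult Q1)
  also have "\<dots> = (content P * content S) * (lead_coeff P' * lead_coeff S')"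
    by (simp only: lcP lcS mult_ac)
  finally have "(content P * content S) * (lead_coeff P' * lead_coeff S') dvd (content P * content S) * 1"
    using k by (metis mult.right_neutral)
  then have "lead_coeff P' * lead_coeff S' dvd 1"
    using nz by (simp only: dvd_mult_cancel_left) auto
  then have "lead_coeff P' dvd 1" by (meson dvd_mult_left)
  then have "content P * lead_coeff P' dvd content P" using mult_dvd_mono[OF dvd_refl, of "lead_coeff P'" 1 "content P"] by simp
  then show ?thesis unfolding lcP using content_dvd_coeff dvd_trans by blast
qed

section \<open>Principal vanishing ideals\<close>

lemma sum_fun_apply: "(\<Sum>i\<in>S. H i) c = (\<Sum>i\<in>S. H i c)" for H :: "'i \<Rightarrow> 'a \<Rightarrow> complex"
  by (induction S rule: infinite_finite_induct) auto

lemma power_fun_apply: "(G ^ i) c = G c ^ i" for G :: "'a \<Rightarrow> complex"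
  by (induction i) auto

text \<open>All coefficients have to stay in the subset \<open>R\<close>, and nothing may be
  cancelled, since the surrounding ring can have zero divisors. The alternative \<open>N = 0\<close>
  covers constant \<open>P\<close>.\<close>

lemma poly_ring_pseudo_divide:
  fixes P :: "'a::comm_ring_1 poly"
  assumes "0 \<in> R" "1 \<in> R" and plus: "\<And>x y. x \<in> R \<Longrightarrow> y \<in> R \<Longrightarrow> x + y \<in> R"
    and minus: "\<And>x y. x \<in> R \<Longrightarrow> y \<in> R \<Longrightarrow> x - y \<in> R"
    and times: "\<And>x y. x \<in> R \<Longrightarrow> y \<in> R \<Longrightarrow> x * y \<in> R"
    and P: "P \<in> polys_over R" and "Q \<in> polys_over R"
  shows "\<exists>m. \<exists>S\<in>polys_over R. \<exists>N\<in>polys_over R. smult (lead_coeff P ^ m) Q = P * S + N \<and>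
    (N = 0 \<or> degree N < degree P)"
proof -
  define d l where "d = degree P" and "l = lead_coeff P"
  have mult: "U * V \<in> polys_over R" if "U \<in> polys_over R" "V \<in> polys_over R" for U V
  proof -
    have s: "(\<Sum>i\<in>S. f i) \<in> R" if "\<And>i. i \<in> S \<Longrightarrow> f i \<in> R" for f and S :: "nat set"
      using that by (induction S rule: infinite_finite_induct) (auto intro: assms)
    then show ?thesis using that by (auto simp: polys_over_def coeff_mult intro!: s times)
  qed
  have pw: "l ^ m \<in> R" for m using P
    by (induction m) (auto intro: assms simp: polys_over_def l_def)
  \<comment> \<open>The induction is on a bound \<open>n\<close> for the degree: subtracting a
    multiple of \<open>P\<close> kills coefficient \<open>n\<close>, whether or not it was zero
    before.\<close>
  have "\<exists>m. \<exists>S\<in>polys_over R. \<exists>N\<in>polys_over R. smult (l ^ m) Q = P * S + N \<and>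
    (N = 0 \<or> degree N < d)"
    if "Q \<in> polys_over R" "\<And>i. i \<ge> n \<Longrightarrow> coeff Q i = 0" for n Q
    using that
  proof (induction n arbitrary: Q)
    case 0
    then have "Q = 0" by (auto simp: poly_eq_iff)
    then show ?case using \<open>0 \<in> R\<close>
      by (intro exI[of _ 0] bexI[of _ 0]) (auto simp: polys_over_def)
  next
    case (Suc n)
    show ?case
    proof (cases "Q = 0 \<or> degree Q < d")
      case True
      then show ?thesis using \<open>0 \<in> R\<close> Suc.prems
        by (intro exI[of _ 0] bexI[of _ 0] bexI[of _ Q]) (auto simp: polys_over_def)
    next
      case False
      then have nd: "n \<ge> d" using Suc.prems(2)[of "degree Q"] by (force simp: not_less_eq_eq)
      define M where "M = monom (coeff Q n) (n - d)"
      define Q' where "Q' = smult l Q - P * M"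
      have M: "M \<in> polys_over R" using Suc.prems \<open>0 \<in> R\<close> by (auto simp: polys_over_def M_def)
      have "Q' \<in> polys_over R" using Suc.prems(1) mult[OF P M] pw[of 1]
        by (auto simp: Q'_def polys_over_def intro!: minus times)
      moreover have "coeff Q' i = 0" if "i \<ge> n" for i
      proof (cases "i = n")
        case True
        then show ?thesis using nd
          by (simp add: Q'_def M_def mult.commute[of P] coeff_monom_mult l_def d_def)
      next
        case False
        then show ?thesis using nd that Suc.prems(2)[of i]
          by (simp add: Q'_def M_def mult.commute[of P] coeff_monom_mult d_def coeff_eq_0)
      qed
      ultimately obtain m S N where *: "S \<in> polys_over R" "N \<in> polys_over R"
        "smult (l ^ m) Q' = P * S + N" "N = 0 \<or> degree N < d"
        using Suc.IH[of Q'] by blast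
      have "smult (l ^ Suc m) Q = smult (l ^ m) (Q' + P * M)"
        by (simp add: Q'_def mult.commute)
      also have "\<dots> = P * (S + smult (l ^ m) M) + N"
        by (simp add: smult_add_right *(3) algebra_simps)
      finally have "smult (l ^ Suc m) Q = P * (S + smult (l ^ m) M) + N" .
      moreover have "S + smult (l ^ m) M \<in> polys_over R"
        using * M pw by (auto simp: polys_over_def intro!: plus times)
      ultimately show ?thesis using * by blast
    qed
  qed
  from this[OF \<open>Q \<in> polys_over R\<close>, of "Suc (degree Q)"] show ?thesis
    by (auto simp: d_def l_def coeff_eq_0)
qed

text \<open>\<open>R\<close> consists of the polynomial functions of the coordinates transversal to \<open>w0\<close> and \<open>T\<close> is
  the coordinate along \<open>w0\<close>, so that \<^term>\<open>polyfun A\<close> is the polynomial ring \<open>R[T]\<close>. An element of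
  the ideal of least degree in \<open>T\<close> can be divided by its leading coefficient: by Gauss' lemma on
  every line, because it divides an element of the ideal that is monic up to a factor in \<open>R\<close>.\<close>

locale vanishing_ideal =
  fixes A :: "'x set" and Z :: "('x \<Rightarrow> complex) set" and w0 :: "'x \<Rightarrow> complex" and a0 :: 'x
    and p0 :: "('x \<Rightarrow> complex) \<Rightarrow> complex" and P0 :: "(('x \<Rightarrow> complex) \<Rightarrow> complex) poly"
  fixes I
  assumes I_def: "I = {f \<in> polyfun A. \<forall>z\<in>Z. f z = 0}"
    and a0: "a0 \<in> A" "w0 a0 \<noteq> 0"
    and prime: "\<And>f g. f \<in> polyfun A \<Longrightarrow> g \<in> polyfun A \<Longrightarrow> f * g \<in> I \<Longrightarrow> f \<in> I \<or> g \<in> I"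
    and no_invariant: "\<And>g. g \<in> I \<Longrightarrow> (\<And>c t. g (\<lambda>a. c a + t * w0 a) = g c) \<Longrightarrow> g = 0"
    and p0: "p0 \<in> I" "P0 \<in> polys_over (polyfun A)" "lead_coeff P0 = 1"
      "\<And>c t. p0 (\<lambda>a. c a + t * w0 a) = poly P0 (\<lambda>_. t) c"
begin

definition "T = (\<lambda>c. c a0 * inverse (w0 a0))"

definition "shift c t = (\<lambda>a. c a + t * w0 a)"

text \<open>Projection along \<open>w0\<close> onto the hyperplane \<open>T = 0\<close>. Composing
  with it makes a function invariant under the shift.\<close>

definition "base c = shift c (- T c)"

definition "R = {f \<in> polyfun A. \<forall>c t. f (shift c t) = f c}"

lemma T_shift: "T (shift c t) = T c + t"
  using a0 by (simp add: T_def shift_def algebra_simps)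

lemma base_shift: "base (shift c t) = base c"
  by (simp add: base_def T_shift) (simp add: shift_def algebra_simps)

lemma shift_base: "shift (base c) (T c) = c"
  by (simp add: base_def shift_def)

lemma T_polyfun: "T \<in> polyfun A"
  unfolding T_def by (intro polyfun_mult polyfun_var polyfun_const a0)

lemma base_polyfun:
  assumes "f \<in> polyfun A" shows "f \<circ> base \<in> polyfun A"
proof -
  have "(\<lambda>c. base c a) \<in> polyfun A" if "a \<in> A" for a
  proof -
    have "(\<lambda>c. c a - T c * w0 a) \<in> polyfun A"
      by (intro polyfun_diff polyfun_var polyfun_mult polyfun_const T_polyfun that)
    then show ?thesis by (simp add: base_def shift_def)
  qed
  from polyfun_subst[OF assms this] show ?thesis by (simp add: comp_def)
qed

lemma R_ring:
  "0 \<in> R" "1 \<in> R" "x \<in> R \<Longrightarrow> y \<in> R \<Longrightarrow> x + y \<in> R" "x \<in> R \<Longrightarrow> y \<in> R \<Longrightarrow> x - y \<in> R"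
  "x \<in> R \<Longrightarrow> y \<in> R \<Longrightarrow> x * y \<in> R"
  by (auto simp: R_def polyfun_zero polyfun_one polyfun_plus polyfun_minus polyfun_times)

lemma poly_T_polyfun:
  assumes "P \<in> polys_over R" shows "poly P T \<in> polyfun A"
proof -
  have "(\<lambda>c. poly P T c) \<in> polyfun A" unfolding poly_fun_apply
    using assms by (intro polyfun_sum polyfun_mult polyfun_power T_polyfun) (auto simp: polys_over_def R_def)
  then show ?thesis by simp
qed

text \<open>The coefficients of the expansion at \<open>c\<close> vary along \<open>w0\<close>.
  Expanding at \<open>base c\<close> instead makes them invariant, and \<open>T c\<close> is the
  time that leads from \<open>base c\<close> back to \<open>c\<close>.\<close>

lemma descend:
  assumes "Q \<in> polys_over (polyfun A)" "\<And>c t. f (shift c t) = poly Q (\<lambda>_. t) c"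
  defines "P \<equiv> map_poly (\<lambda>g. g \<circ> base) Q"
  shows "P \<in> polys_over R" "f = poly P T"
proof -
  have co: "coeff P i = coeff Q i \<circ> base" for i
    unfolding P_def by (subst coeff_map_poly) (auto simp: fun_eq_iff)
  show "P \<in> polys_over R" using assms(1) base_polyfun
    by (auto simp: polys_over_def co R_def base_shift)
  have "eval_coeffs P c = eval_coeffs Q (base c)" for c by (simp add: poly_eq_iff co)
  then have "f c = poly P T c" for c
    using assms(2)[of "base c" "T c"] poly_eval_coeffs[of Q "base c" "\<lambda>_. T c"] poly_eval_coeffs[of P c T]
    by (simp add: shift_base)
  then show "f = poly P T" by blast
qed

lemma representation:
  assumes "f \<in> polyfun A" obtains P where "P \<in> polys_over R" "f = poly P T"
proof -
  obtain Q where "Q \<in> polys_over (polyfun A)" "\<And>c t. f (\<lambda>a. c a + t * w0 a) = poly Q (\<lambda>_. t) c"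
    by (rule polyfun_expand[OF assms, of "\<lambda>a c. c a" A "\<lambda>a _. w0 a"])
      (auto intro: polyfun_const polyfun_var)
  then show ?thesis using descend[of Q f] that by (auto simp: shift_def)
qed

text \<open>Along \<open>w0\<close> the coefficients stay fixed while \<open>T\<close> takes every
  complex value.\<close>

lemma poly_T_eq_0:
  assumes "P \<in> polys_over R" "poly P T = 0" shows "P = 0"
proof -
  have "coeff P i c = 0" for i c
  proof -
    have "poly (eval_coeffs P c) s = 0" for s
    proof -
      have "eval_coeffs P (shift c (s - T c)) = eval_coeffs P c"
        using assms(1) by (auto simp: poly_eq_iff polys_over_def R_def)
      then show ?thesis using assms(2) poly_eval_coeffs[of P "shift c (s - T c)" T] by (simp add: T_shift)
    qed
    then have "eval_coeffs P c = 0" using poly_all_0_iff_0 by blast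
    then show ?thesis by (metis coeff_0 coeff_eval_coeffs)
  qed
  then show ?thesis by (auto simp: poly_eq_iff fun_eq_iff)
qed

lemma ideal_mult: "f \<in> I \<Longrightarrow> g \<in> polyfun A \<Longrightarrow> f * g \<in> I"
  by (auto simp: I_def polyfun_times)

lemma ideal_minus: "f \<in> I \<Longrightarrow> g \<in> I \<Longrightarrow> f - g \<in> I"
  by (auto simp: I_def polyfun_minus)

definition minimal where
  "minimal P \<longleftrightarrow> P \<in> polys_over R \<and> P \<noteq> 0 \<and> poly P T \<in> I \<and>
     (\<forall>Q\<in>polys_over R. poly Q T \<in> I \<longrightarrow> Q \<noteq> 0 \<longrightarrow> degree P \<le> degree Q)"

text \<open>The remainder of pseudo-division lies in the ideal and contradicts minimality unless it
  is zero.\<close>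

lemma minimal_divides:
  assumes P: "minimal P" and Q: "Q \<in> polys_over R" "poly Q T \<in> I"
  shows "\<exists>m. \<exists>S\<in>polys_over R. smult (lead_coeff P ^ m) Q = P * S"
proof -
  have PR: "P \<in> polys_over R" and PI: "poly P T \<in> I" using P by (auto simp: minimal_def)
  obtain m S N where *: "S \<in> polys_over R" "N \<in> polys_over R"
    "smult (lead_coeff P ^ m) Q = P * S + N" "N = 0 \<or> degree N < degree P"
    using poly_ring_pseudo_divide[OF R_ring PR Q(1)] by blast
  have pw: "lead_coeff P ^ m \<in> polyfun A"
    using PR by (induction m) (auto simp: polys_over_def R_def polyfun_one intro!: polyfun_times)
  have "poly N T = poly Q T * lead_coeff P ^ m - poly P T * poly S T"
    using arg_cong[OF *(3), of "\<lambda>p. poly p T"] by (simp add: algebra_simps)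
  also have "\<dots> \<in> I" by (intro ideal_minus ideal_mult pw Q PI poly_T_polyfun *)
  finally have "N = 0" using * P by (auto simp: minimal_def) 
  then show ?thesis using * by auto
qed

lemma ex_minimal: "\<exists>P. minimal P"
proof -
  obtain Q where Q: "Q \<in> polys_over R" "poly Q T \<in> I" "Q \<noteq> 0"
  proof -
    obtain Q where Q: "Q \<in> polys_over R" "p0 = poly Q T"
      using representation p0(1) by (auto simp: I_def)
    have "eval_coeffs P0 c \<noteq> 0" for c
      using p0(3) by (metis coeff_0 coeff_eval_coeffs one_fun_apply zero_neq_one)
    then have "p0 \<noteq> 0"
      using p0(4)[of 0] poly_eval_coeffs[of P0 0 "\<lambda>_. t" for t] poly_all_0_iff_0[of "eval_coeffs P0 0"]
      by (metis zero_fun_apply)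
    then show ?thesis using that Q p0(1) by force
  qed
  then show ?thesis
    using ex_has_least_nat[of "\<lambda>Q. Q \<in> polys_over R \<and> poly Q T \<in> I \<and> Q \<noteq> 0" Q degree]
    unfolding minimal_def by blast
qed

lemma lead_coeff_dvd_coeff:
  assumes P: "minimal P"
  shows "\<exists>h\<in>polyfun A. coeff P i = lead_coeff P * h"
proof -
  have PR: "P \<in> polys_over R" and "lead_coeff P \<noteq> 0" using P by (auto simp: minimal_def)
  then obtain b where b: "lead_coeff P b \<noteq> 0" by (auto simp: fun_eq_iff)
  \<comment> \<open>This is \<open>p0\<close> rewritten over \<open>R\<close>: the monic polynomial
    in \<open>T\<close> that Gauss' lemma requires.\<close>
  define Q where "Q = map_poly (\<lambda>g. g \<circ> base) P0"
  have coQ: "coeff Q i = coeff P0 i \<circ> base" for i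
    unfolding Q_def by (subst coeff_map_poly) (auto simp: fun_eq_iff)
  have QR: "Q \<in> polys_over R" "p0 = poly Q T"
    using descend[OF p0(2), of p0] p0(4) by (auto simp: shift_def Q_def)
  obtain m S where S: "S \<in> polys_over R" "smult (lead_coeff P ^ m) Q = P * S"
    using minimal_divides[OF P QR(1)] QR(2) p0(1) by blast
  have "\<exists>h. \<forall>s. coeff P i (\<lambda>a. b a + s * e a) = lead_coeff P (\<lambda>a. b a + s * e a) * poly h s" for e
  proof -
    \<comment> \<open>Restriction to the line as a polynomial in \<open>s\<close>. A complex
      polynomial is determined by its values, so the choice is unique and identities can be checked
      pointwise.\<close>
    define lp where "lp f = (SOME q. \<forall>s. f (\<lambda>a. b a + s * e a) = poly q s)"
      for f :: "('x \<Rightarrow> complex) \<Rightarrow> complex"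
    have lp: "poly (lp f) s = f (\<lambda>a. b a + s * e a)" if fA: "f \<in> polyfun A" for f s
    proof -
      obtain q where "\<And>s. f (\<lambda>a. b a + s * e a) = poly q s"
        using polyfun_line[OF fA, of b e] by blast
      then have "\<exists>q. \<forall>s. f (\<lambda>a. b a + s * e a) = poly q s" by blast
      from someI_ex[OF this, folded lp_def] show ?thesis by metis
    qed
    have lp0: "lp 0 = 0" 
    proof (rule poly_eq_poly_eq_iff[THEN iffD1], rule ext)
      show "poly (lp 0) s = poly 0 s" for s by (subst lp[OF polyfun_zero]) simp
    qed
    have lp1: "lp 1 = 1"
    proof (rule poly_eq_poly_eq_iff[THEN iffD1], rule ext)
      show "poly (lp 1) s = poly 1 s" for s by (subst lp[OF polyfun_one]) simp
    qed
    define M where "M = map_poly lp"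
    have M: "coeff (M U) j = lp (coeff U j)" for U j
      by (simp add: M_def coeff_map_poly lp0)
    have pf: "coeff U j \<in> polyfun A" if "U \<in> polys_over R" for U j
      using that by (auto simp: polys_over_def R_def)
    have deg: "degree (M U) = degree U" if "lp (lead_coeff U) \<noteq> 0" for U
      using that by (intro antisym degree_le le_degree) (auto simp: M coeff_eq_0 lp0)
    have lcQ: "lead_coeff Q = 1"
    proof -
      have "degree Q = degree P0"
        using p0(3) by (intro antisym degree_le le_degree)
          (auto simp: coQ coeff_eq_0 fun_eq_iff)
      then show ?thesis using p0(3) by (simp add: coQ fun_eq_iff)
    qed
    \<comment> \<open>Every line considered passes through \<open>b\<close> at \<open>s = 0\<close>,
      where the leading coefficient is nonzero; so restriction keeps the degree.\<close>
    have "lp (lead_coeff P) \<noteq> 0"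
      using b lp[OF pf[OF PR], of "degree P" 0] by auto
    then have degP: "degree (M P) = degree P" by (rule deg)
    have degQ: "degree (M Q) = degree Q" by (rule deg) (simp add: lcQ lp1)
    have "smult (lp (lead_coeff P) ^ m) (M Q) = M P * M S"
    proof (rule poly_eqI, rule poly_eq_poly_eq_iff[THEN iffD1], rule ext)
      fix j s
      let ?c = "\<lambda>a. b a + s * e a"
      have "poly (coeff (M P * M S) j) s =
          (\<Sum>k\<le>j. poly (lp (coeff P k)) s * poly (lp (coeff S (j - k))) s)"
        by (simp add: coeff_mult M poly_sum)
      also have "\<dots> = (\<Sum>k\<le>j. coeff P k ?c * coeff S (j - k) ?c)"
        by (simp only: lp[OF pf[OF PR]] lp[OF pf[OF S(1)]])
      also have "\<dots> = coeff (P * S) j ?c"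
        by (simp add: coeff_mult sum_fun_apply)
      also have "\<dots> = coeff (smult (lead_coeff P ^ m) Q) j ?c" by (simp only: S(2))
      also have "\<dots> = poly (lp (lead_coeff P)) s ^ m * poly (lp (coeff Q j)) s"
        by (simp only: lp[OF pf[OF PR]] lp[OF pf[OF QR(1)]] coeff_smult times_fun_apply power_fun_apply)
      also have "\<dots> = poly (coeff (smult (lp (lead_coeff P) ^ m) (M Q)) j) s"
        by (simp add: M)
      finally show "poly (coeff (smult (lp (lead_coeff P) ^ m) (M Q)) j) s = poly (coeff (M P * M S) j) s"
        by (rule sym)
    qed
    then have "lead_coeff (M P) dvd coeff (M P) i"
      by (rule lead_coeff_dvd_if_dvd_monic[rotated])
        (use \<open>lp (lead_coeff P) \<noteq> 0\<close> lcQ lp1 in \<open>auto simp: degQ M\<close>)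
    then obtain h where "lp (coeff P i) = lp (lead_coeff P) * h"
      by (auto simp: M degP dvd_def)
    then have "coeff P i (\<lambda>a. b a + s * e a) = lead_coeff P (\<lambda>a. b a + s * e a) * poly h s" for s
      using lp[OF pf[OF PR], of i s] lp[OF pf[OF PR], of "degree P" s] by (metis poly_mult)
    then show ?thesis by blast
  qed
  note on_lines = this
  have pf: "coeff P j \<in> polyfun A" for j using PR by (auto simp: polys_over_def R_def)
  show ?thesis by (rule polyfun_dvd_if_dvd_on_lines[where b = b, OF pf pf b]) (rule on_lines)
qed

lemma principal: "\<exists>p\<in>I. p \<noteq> 0 \<and> (\<forall>q\<in>I. \<exists>s\<in>polyfun A. q = p * s)"
proof -
  obtain P where P: "minimal P" using ex_minimal by blast
  define l where "l = lead_coeff P"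
  have PR: "P \<in> polys_over R" and l0: "l \<noteq> 0" using P by (auto simp: minimal_def l_def)
  have lR: "l \<in> R" using PR by (auto simp: polys_over_def l_def)
  have lA: "l \<in> polyfun A" using lR by (auto simp: R_def)
  obtain h where h: "\<And>i. h i \<in> polyfun A" "\<And>i. coeff P i = l * h i"
    using lead_coeff_dvd_coeff[OF P] unfolding l_def by metis
  have cancel: "f = g" if "f \<in> polyfun A" "g \<in> polyfun A" "l * f = l * g" for f g
    using polyfun_no_zero_divisors[OF lA polyfun_minus[OF that(1,2)]] that(3) l0
    by (simp add: right_diff_distrib)
  \<comment> \<open>Both \<open>l\<close> and \<open>l * h i\<close> are invariant, and
    \<open>l\<close> can be cancelled.\<close>
  have hR: "h i \<in> R" for i
  proof -
    have "h i (shift c t) = h i c" for c t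
    proof -
      have "(\<lambda>c. h i (shift c t)) \<in> polyfun A" unfolding shift_def
        by (rule polyfun_subst[OF h(1)]) (intro polyfun_add polyfun_const polyfun_var)
      moreover have "l * (\<lambda>c. h i (shift c t)) = l * h i"
      proof
        fix c
        have "coeff P i (shift c t) = coeff P i c" "l (shift c t) = l c"
          using PR lR by (auto simp: polys_over_def R_def)
        then show "(l * (\<lambda>c. h i (shift c t))) c = (l * h i) c" by (simp add: h(2))
      qed
      ultimately show ?thesis using cancel[OF _ h(1)] by metis
    qed
    then show ?thesis using h by (auto simp: R_def)
  qed
  define H where "H = (\<Sum>i\<le>degree P. monom (h i) i)"
  have coH: "coeff H i = (if i \<le> degree P then h i else 0)" for i
    by (simp add: H_def coeff_sum)
  have PH: "P = smult l H" 
  proof (rule poly_eqI)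
    show "coeff P n = coeff (smult l H) n" for n
      using h(2)[of n] by (auto simp: coH coeff_eq_0)
  qed
  have HR: "H \<in> polys_over R" using hR R_ring(1) by (auto simp: polys_over_def coH)
  have hd: "h (degree P) = 1" using cancel[OF h(1) polyfun_one, of "degree P"] h(2)[of "degree P", folded l_def]
    by simp
  have degH: "degree H = degree P"
    by (intro antisym degree_le le_degree) (auto simp: coH hd)
  have lcH: "lead_coeff H = 1" by (simp add: degH coH hd)
  \<comment> \<open>Primality strips off \<open>l\<close>, which is invariant and nonzero and
    therefore outside the ideal.\<close>
  have "l * poly H T \<in> I" using P by (simp add: minimal_def PH)
  moreover have "l \<notin> I" using no_invariant[of l] lR l0 by (auto simp: R_def shift_def)
  ultimately have HI: "poly H T \<in> I" using prime[OF lA poly_T_polyfun[OF HR]] by blast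
  have H0: "H \<noteq> 0" using lcH by force
  have minH: "minimal H" using P HR HI H0 by (auto simp: minimal_def degH)
  show ?thesis
  proof (rule bexI[OF _ HI], intro conjI ballI)
    show "poly H T \<noteq> 0" using poly_T_eq_0[OF HR] H0 by blast
    fix q assume q: "q \<in> I"
    then obtain Q where Q: "Q \<in> polys_over R" "q = poly Q T"
      using representation by (auto simp: I_def)
    then obtain m S where S: "S \<in> polys_over R" "smult (lead_coeff H ^ m) Q = H * S"
      using minimal_divides[OF minH] q by blast
    then have "q = poly H T * poly S T" using Q(2) lcH by simp
    then show "\<exists>s\<in>polyfun A. q = poly H T * s" using poly_T_polyfun[OF S(1)] by blast
  qed
qed

end

section \<open>Affine relations with nondegenerate quadratic form\<close>

definition quad :: "'v::euclidean_space set \<Rightarrow> ('v \<Rightarrow> real) \<Rightarrow> 'v \<Rightarrow> 'v \<Rightarrow> real" where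
  "quad A c v w = (\<Sum>a\<in>A. c a * (v \<bullet> a) * (w \<bullet> a))"

lemma quad_commute: "quad A c v w = quad A c w v"
  by (simp add: quad_def mult_ac)

lemma quad_scaleR: "quad A c (r *\<^sub>R v) w = r * quad A c v w"
  by (simp add: quad_def sum_distrib_left mult_ac)

lemma quad_add_coeff: "quad A (\<lambda>a. c a + e * d a) v w = quad A c v w + e * quad A d v w"
  by (simp add: quad_def sum_distrib_left sum.distrib algebra_simps)

lemma tendsto_quad: "(f \<longlongrightarrow> v) F \<Longrightarrow> ((\<lambda>n. quad A c (f n) w) \<longlongrightarrow> quad A c v w) F"
  unfolding quad_def by (intro tendsto_intros)

text \<open>The assumption says that the form of \<open>d\<close> is nondegenerate on the radical of
  the form of \<open>c\<close>. If the perturbation were degenerate for every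
  \<open>e = 1 / (n + 1)\<close>, unit kernel vectors would accumulate at a unit vector
  \<open>l\<close> in the radical of \<open>c\<close>. Paired with that radical, a kernel vector
  retains only its \<open>d\<close> term, so \<open>l\<close> is also \<open>d\<close>-orthogonal to
  the radical and must be zero.\<close>

lemma quad_perturb:
  fixes A :: "'v::euclidean_space set"
  assumes K: "subspace K"
    and nd: "\<And>v. v \<in> K \<Longrightarrow> (\<And>w. w \<in> K \<Longrightarrow> quad A c v w = 0) \<Longrightarrow>
      (\<And>w. w \<in> K \<Longrightarrow> (\<And>u. u \<in> K \<Longrightarrow> quad A c w u = 0) \<Longrightarrow> quad A d v w = 0) \<Longrightarrow> v = 0"
  shows "\<exists>e. \<forall>v\<in>K. (\<forall>w\<in>K. quad A (\<lambda>a. c a + e * d a) v w = 0) \<longrightarrow> v = 0"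
proof (rule ccontr)
  assume "\<not> ?thesis"
  then have "\<forall>n. \<exists>v. v \<in> K \<and> v \<noteq> 0 \<and>
      (\<forall>w\<in>K. quad A c v w + inverse (real (Suc n)) * quad A d v w = 0)"
    unfolding quad_add_coeff by blast
  then obtain v where v: "\<And>n. v n \<in> K" "\<And>n. v n \<noteq> 0"
    "\<And>n w. w \<in> K \<Longrightarrow> quad A c (v n) w + inverse (real (Suc n)) * quad A d (v n) w = 0" by metis
  define u where "u n = inverse (norm (v n)) *\<^sub>R v n" for n
  have uK: "u n \<in> K \<inter> sphere 0 1" for n
    using v K by (simp add: u_def subspace_mul)
  have u: "quad A c (u n) w + inverse (real (Suc n)) * quad A d (u n) w = 0" if "w \<in> K" for n w
    using v(3)[OF that, of n] unfolding u_def quad_scaleR by (simp add: algebra_simps flip: distrib_left)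
  have "compact (K \<inter> sphere 0 1)"
    using K by (intro closed_Int_compact closed_subspace) auto
  then obtain l r where l: "l \<in> K \<inter> sphere 0 1" and r: "strict_mono (r :: nat \<Rightarrow> nat)"
    and lim: "(u \<circ> r) \<longlonglongrightarrow> l"
    using uK unfolding compact_def by metis
  have "quad A c l w = 0" if "w \<in> K" for w
  proof -
    have "(\<lambda>n. quad A c ((u \<circ> r) n) w + inverse (real (Suc (r n))) * quad A d ((u \<circ> r) n) w)
        \<longlonglongrightarrow> quad A c l w + 0 * quad A d l w"
      using LIMSEQ_subseq_LIMSEQ[OF LIMSEQ_inverse_real_of_nat r]
      by (intro tendsto_add tendsto_mult tendsto_quad lim) (simp add: o_def)
    then show ?thesis using u[OF that] LIMSEQ_unique[OF _ tendsto_const[of 0]] by fastforce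
  qed
  moreover have "quad A d l w = 0" if "w \<in> K" "\<And>u. u \<in> K \<Longrightarrow> quad A c w u = 0" for w
  proof -
    have "quad A d ((u \<circ> r) n) w = 0" for n
      using u[OF that(1), of "r n"] that(2)[of "u (r n)"] uK[of "r n"] by (simp add: quad_commute[of A c _ w])
    then show ?thesis using tendsto_quad[OF lim, of A d w] LIMSEQ_unique[OF _ tendsto_const[of 0]] by fastforce
  qed
  ultimately have "l = 0" using l nd by blast
  then show False using l by simp
qed

text \<open>For distinct \<open>a\<close> and \<open>b\<close> in \<open>A\<close>, take the
  component of \<open>a - b\<close> orthogonal to all differences of the other points with
  \<open>b\<close>. As a functional it is constant on \<open>A - {a}\<close>, and independence makes
  it nonzero.\<close>

lemma affine_independent_in_two_hyperplanes:
  fixes A :: "'v::euclidean_space set"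
  assumes K: "subspace K" "K \<noteq> {0}" and A: "A \<subseteq> K" "\<not> affine_dependent A"
  shows "\<exists>v\<in>K. v \<noteq> 0 \<and> (\<exists>b1 b2. A \<subseteq> {x. v \<bullet> x = b1} \<union> {x. v \<bullet> x = b2})"
proof (cases "\<exists>a b. a \<in> A \<and> b \<in> A \<and> a \<noteq> b")
  case False
  obtain v where "v \<in> K" "v \<noteq> 0" using K subspace_0 by blast
  moreover have "A \<subseteq> {x. v \<bullet> x = v \<bullet> (SOME a. a \<in> A)}"
    using False someI[of "\<lambda>a. a \<in> A"] by blast
  ultimately show ?thesis by blast
next
  case True
  then obtain a b where ab: "a \<in> A" "b \<in> A" "a \<noteq> b" by blast
  define B where "B = {x - b |x. x \<in> A - {a} - {b}}"
  have "a \<notin> affine hull (A - {a})" using A ab by (auto simp: affine_dependent_def)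
  then have nB: "a - b \<notin> span B"
    using ab affine_hull_span[of b "A - {a}"] unfolding B_def by force
  obtain y z where yz: "y \<in> span B" "\<And>w. w \<in> span B \<Longrightarrow> orthogonal z w" "a - b = y + z"
    using orthogonal_subspace_decomp_exists[of B "a - b"] by metis
  have "span B \<subseteq> K" using A K(1) ab by (intro span_minimal) (auto simp: B_def intro!: subspace_diff)
  then have "y \<in> K" using yz by blast
  moreover have "a - b \<in> K" using A K(1) ab by (intro subspace_diff) auto
  ultimately have "z \<in> K" using subspace_diff[OF K(1)] yz(3) by (metis add_diff_cancel_left')
  moreover have "z \<noteq> 0" using nB yz by auto
  moreover have "A \<subseteq> {x. z \<bullet> x = z \<bullet> a} \<union> {x. z \<bullet> x = z \<bullet> b}"
  proof
    fix x assume "x \<in> A"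
    show "x \<in> {x. z \<bullet> x = z \<bullet> a} \<union> {x. z \<bullet> x = z \<bullet> b}"
    proof (cases "x = a \<or> x = b")
      case False
      then have "x - b \<in> span B" using \<open>x \<in> A\<close> by (intro span_base) (auto simp: B_def)
      from yz(2)[OF this] show ?thesis by (auto simp: orthogonal_def inner_diff_right)
    qed auto
  qed
  ultimately show ?thesis by blast
qed

text \<open>If \<open>C \<subseteq> A\<close> is a minimal affinely dependent set, the form of its affine relation is
  degenerate precisely on the functionals that are constant on \<open>C\<close>; contract \<open>C\<close> and induct.\<close>

lemma ex_affine_relation_nondegenerate:
  fixes A K :: "'v::euclidean_space set"
  assumes "subspace K" "finite A" "A \<subseteq> K"
    and "\<And>v b1 b2. v \<in> K \<Longrightarrow> v \<noteq> 0 \<Longrightarrow> \<not> A \<subseteq> {x. v \<bullet> x = b1} \<union> {x. v \<bullet> x = b2}"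
  shows "\<exists>c. (\<Sum>a\<in>A. c a) = 0 \<and> (\<Sum>a\<in>A. c a *\<^sub>R a) = 0 \<and>
    (\<forall>v\<in>K. (\<forall>w\<in>K. quad A c v w = 0) \<longrightarrow> v = 0)"
  using assms
proof (induction "dim K" arbitrary: K A rule: less_induct)
  case less
  note K = \<open>subspace K\<close> and fin = \<open>finite A\<close> and AK = \<open>A \<subseteq> K\<close>
  show ?case
  proof (cases "K = {0}")
    case True
    then show ?thesis by (intro exI[of _ "\<lambda>_. 0"]) auto
  next
    case False
    then have "affine_dependent A"
      using affine_independent_in_two_hyperplanes[OF K _ AK] less.prems(4) by blast
    then obtain C where C: "C \<subseteq> A" "affine_dependent C"
      and Cmin: "\<And>D. D \<subseteq> A \<Longrightarrow> affine_dependent D \<Longrightarrow> card C \<le> card D"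
      using ex_has_least_nat[of "\<lambda>C. C \<subseteq> A \<and> affine_dependent C" A card] by auto
    have finC: "finite C" using C fin finite_subset by blast
    obtain c where c: "(\<Sum>a\<in>C. c a) = 0" "\<exists>a\<in>C. c a \<noteq> 0" "(\<Sum>a\<in>C. c a *\<^sub>R a) = 0"
      using C affine_dependent_explicit_finite[OF finC] by metis
    \<comment> \<open>A nonzero relation that misses a point of \<open>C\<close> would make a
      smaller set dependent.\<close>
    have vanish: "d a = 0" if d: "(\<Sum>a\<in>C. d a) = 0" "(\<Sum>a\<in>C. d a *\<^sub>R a) = 0"
      and b: "b \<in> C" "d b = 0" and a: "a \<in> C" for d a b
    proof (rule ccontr)
      assume "d a \<noteq> 0"
      have "(\<Sum>a\<in>C - {b}. d a) = 0" "(\<Sum>a\<in>C - {b}. d a *\<^sub>R a) = 0"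
        using d b finC by (simp_all add: sum.remove[of C b])
      moreover have "\<exists>a\<in>C - {b}. d a \<noteq> 0" using a b \<open>d a \<noteq> 0\<close> by auto
      ultimately have "affine_dependent (C - {b})"
        using affine_dependent_explicit_finite[of "C - {b}"] finC by auto
      then have "card C \<le> card (C - {b})" using Cmin C by blast
      then show False using b finC by (meson card_Diff1_less leD)
    qed
    have c0: "c a \<noteq> 0" if "a \<in> C" for a
      using vanish[OF c(1,3) that] c(2) by blast
    obtain a0 where a0: "a0 \<in> C" using c by blast
    obtain a1 where a1: "a1 \<in> C" "a1 \<noteq> a0"
    proof (rule ccontr)
      assume "\<not> thesis"
      then have "C = {a0}" using a0 that by blast
      then show False using c by simp
    qed
    define B where "B = (\<lambda>a. a - a0) ` C"
    \<comment> \<open>The contraction of \<open>C\<close>: as functionals, the elements of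
      \<open>K'\<close> are those constant on \<open>C\<close>; as points, they represent
      \<open>K\<close> modulo the directions of \<open>C\<close>.\<close>
    define K' where "K' = {v \<in> K. \<forall>s\<in>span B. v \<bullet> s = 0}"
    have K': "subspace K'" using K
      by (auto simp: K'_def subspace_def inner_add_left)
    have BK: "span B \<subseteq> K" using AK K C a0
      by (intro span_minimal) (auto simp: B_def subset_iff intro!: subspace_diff)
    have const: "v \<bullet> a = v \<bullet> a0" if "v \<in> K'" "a \<in> C" for v a
      using that span_base[of "a - a0" B] by (auto simp: K'_def B_def inner_diff_right)
    have K'I: "v \<in> K'" if "v \<in> K" "\<And>a. a \<in> C \<Longrightarrow> v \<bullet> a = v \<bullet> a0" for v
    proof -
      have "orthogonal v s" if "s \<in> span B" for s
        using that by (rule orthogonal_to_span) (auto simp: B_def orthogonal_def inner_diff_right \<open>\<And>a. a \<in> C \<Longrightarrow> v \<bullet> a = v \<bullet> a0\<close>)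
      then show ?thesis using that by (auto simp: K'_def orthogonal_def)
    qed
    have "a1 - a0 \<in> K" "a1 - a0 \<notin> K'"
      using a0 a1 AK C K subspace_diff const[of "a1 - a0" a1]
      by (blast, metis const diff_eq_diff_eq inner_diff_right inner_eq_zero_iff right_minus_eq)
    then have "K' \<subset> K" by (auto simp: K'_def)
    then have dim: "dim K' < dim K"
      using dim_psubset[of K' K] K K' by (metis span_eq_iff)
    have "\<exists>z\<in>K'. x - z \<in> span B" if "x \<in> K" for x
    proof -
      obtain y z where yz: "y \<in> span B" "\<And>w. w \<in> span B \<Longrightarrow> orthogonal z w" "x = y + z"
        using orthogonal_subspace_decomp_exists[of B x] by metis
      have "z \<in> K" using yz BK that K subspace_diff by (metis add_diff_cancel_left' subsetD)
      then show ?thesis using yz by (auto simp: K'_def orthogonal_def intro!: bexI[of _ z])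
    qed
    then obtain pr where pr: "\<And>x. x \<in> K \<Longrightarrow> pr x \<in> K'" "\<And>x. x \<in> K \<Longrightarrow> x - pr x \<in> span B" by metis
    have inner_pr: "v \<bullet> pr x = v \<bullet> x" if "v \<in> K'" "x \<in> K" for v x
      using that pr(2)[of x] by (auto simp: K'_def inner_diff_right)
    have "\<not> pr ` A \<subseteq> {x. v \<bullet> x = b1} \<union> {x. v \<bullet> x = b2}" if "v \<in> K'" "v \<noteq> 0" for v b1 b2
    proof
      assume *: "pr ` A \<subseteq> {x. v \<bullet> x = b1} \<union> {x. v \<bullet> x = b2}"
      have "A \<subseteq> {x. v \<bullet> x = b1} \<union> {x. v \<bullet> x = b2}"
      proof
        fix x assume "x \<in> A"
        then have "pr x \<in> {x. v \<bullet> x = b1} \<union> {x. v \<bullet> x = b2}" using * by blast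
        then show "x \<in> {x. v \<bullet> x = b1} \<union> {x. v \<bullet> x = b2}" using inner_pr[OF that(1), of x] \<open>x \<in> A\<close> AK by auto
      qed
      then show False using less.prems(4)[of v b1 b2] that by (auto simp: K'_def)
    qed
    moreover have "pr ` A \<subseteq> K'" using pr AK by blast
    ultimately obtain c' where c': "(\<Sum>a\<in>pr ` A. c' a) = 0" "(\<Sum>a\<in>pr ` A. c' a *\<^sub>R a) = 0"
      "\<And>v. v \<in> K' \<Longrightarrow> (\<And>w. w \<in> K' \<Longrightarrow> quad (pr ` A) c' v w = 0) \<Longrightarrow> v = 0"
      using less.hyps[OF dim K', of "pr ` A"] fin by blast
    \<comment> \<open>Several points of \<open>A\<close> may have the same projection; one of them
      carries the whole coefficient.\<close>
    obtain U where U: "U \<subseteq> A" "inj_on pr U" "pr ` A = pr ` U"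
      using subset_image_inj[of "pr ` A" pr A] by blast
    define c1 where "c1 a = (if a \<in> U then c' (pr a) else 0)" for a
    have c1_sum: "(\<Sum>a\<in>A. c1 a * f (pr a)) = (\<Sum>b\<in>pr ` A. c' b * f b)" for f
    proof -
      have "(\<Sum>a\<in>A. c1 a * f (pr a)) = (\<Sum>a\<in>U. c' (pr a) * f (pr a))"
        using U fin by (intro sum.mono_neutral_cong_right) (auto simp: c1_def)
      then show ?thesis by (simp add: U(3) sum.reindex[OF U(2)] o_def)
    qed
    have c1_sum': "(\<Sum>a\<in>A. c1 a *\<^sub>R pr a) = 0"
    proof -
      have "(\<Sum>a\<in>A. c1 a *\<^sub>R pr a) = (\<Sum>a\<in>U. c' (pr a) *\<^sub>R pr a)"
        using U fin by (intro sum.mono_neutral_cong_right) (auto simp: c1_def)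
      then show ?thesis using c'(2) by (simp add: U(3) sum.reindex[OF U(2)] o_def)
    qed
    have "(\<Sum>a\<in>A. c1 a *\<^sub>R a) = (\<Sum>a\<in>A. c1 a *\<^sub>R (a - pr a))"
      by (simp add: scaleR_diff_right sum_subtractf c1_sum')
    also have "\<dots> \<in> span B" using pr AK by (intro span_sum span_scale) auto
    finally obtain d where d: "(\<Sum>a\<in>A. c1 a *\<^sub>R a) = (\<Sum>b\<in>B. d b *\<^sub>R b)"
      using span_finite[of B] finC by (auto simp: B_def)
    define D where "D a = d (a - a0)" for a
    have d': "(\<Sum>a\<in>A. c1 a *\<^sub>R a) = (\<Sum>a\<in>C. D a *\<^sub>R (a - a0))"
      unfolding d B_def by (subst sum.reindex) (auto simp: inj_on_def D_def)
    \<comment> \<open>\<open>c1\<close> is a relation only modulo the span of \<open>B\<close>.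
      Coefficients on \<open>C\<close> remove the defect, and \<open>a0\<close> restores the total.
      Elements of \<open>K'\<close> are constant on \<open>C\<close>, so the form on
      \<open>K'\<close> does not change.\<close>
    define c2 where "c2 a = c1 a - (if a \<in> C then D a else 0) + (if a = a0 then sum D C else 0)" for a
    have c2: "(\<Sum>a\<in>A. c2 a *\<^sub>R f a) = (\<Sum>a\<in>A. c1 a *\<^sub>R f a) - (\<Sum>a\<in>C. D a *\<^sub>R (f a - f a0))"
      for f :: "'v \<Rightarrow> 'b::real_vector"
    proof -
      have "(\<Sum>a\<in>A. (if a \<in> C then D a else 0) *\<^sub>R f a) = (\<Sum>a\<in>C. D a *\<^sub>R f a)"
        using C fin by (intro sum.mono_neutral_cong_right) auto
      moreover have "(\<Sum>a\<in>A. (if a = a0 then sum D C else 0) *\<^sub>R f a) = sum D C *\<^sub>R f a0"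
        using C a0 fin by (subst sum.remove[of A a0]) (auto intro!: sum.neutral)
      ultimately show ?thesis
        by (simp add: c2_def scaleR_left_distrib scaleR_left_diff_distrib sum.distrib sum_subtractf
            scaleR_diff_right scaleR_sum_left)
    qed
    have c2_1: "(\<Sum>a\<in>A. c2 a) = 0" using c2[of "\<lambda>_. 1::real"] c1_sum[of "\<lambda>_. 1"] c'(1) by simp
    have c2_2: "(\<Sum>a\<in>A. c2 a *\<^sub>R a) = 0" using c2[of "\<lambda>a. a"] d' by simp
    have c2_3: "quad A c2 v w = quad (pr ` A) c' v w" if "v \<in> K'" "w \<in> K'" for v w
    proof -
      have "quad A c2 v w = (\<Sum>a\<in>A. c1 a * ((v \<bullet> a) * (w \<bullet> a)))"
        using c2[of "\<lambda>a. (v \<bullet> a) * (w \<bullet> a)"] const that by (simp add: quad_def mult.assoc)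
      also have "\<dots> = (\<Sum>a\<in>A. c1 a * ((v \<bullet> pr a) * (w \<bullet> pr a)))"
        using that AK by (intro sum.cong refl) (auto simp: inner_pr)
      also have "\<dots> = quad (pr ` A) c' v w"
        using c1_sum[of "\<lambda>a. (v \<bullet> a) * (w \<bullet> a)"] by (simp add: quad_def mult.assoc)
      finally show ?thesis .
    qed
    define cc where "cc a = (if a \<in> C then c a else 0)" for a
    have cc: "(\<Sum>a\<in>A. cc a *\<^sub>R f a) = (\<Sum>a\<in>C. c a *\<^sub>R f a)" for f :: "'v \<Rightarrow> 'b::real_vector"
      using C fin unfolding cc_def by (intro sum.mono_neutral_cong_right) auto
    have quad_cc: "quad A cc v w = (\<Sum>a\<in>C. c a * (v \<bullet> a) * (w \<bullet> a))" for v w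
      using cc[of "\<lambda>a. (v \<bullet> a) * (w \<bullet> a)"] by (simp add: quad_def mult.assoc)
    have kernel: "v \<in> K'" if "v \<in> K" "\<And>w. w \<in> K \<Longrightarrow> quad A cc v w = 0" for v
    proof (rule K'I[OF that(1)])
      fix a assume a: "a \<in> C"
      \<comment> \<open>\<open>f\<close> is again an affine relation on \<open>C\<close>: the kernel
        condition gives the vector part, the relation \<open>c\<close> the sum. It is zero at
        \<open>a0\<close>, hence on all of \<open>C\<close>.\<close>
      define f where "f a = c a * (v \<bullet> a - v \<bullet> a0)" for a
      define s where "s = (\<Sum>a\<in>C. f a *\<^sub>R a)"
      have "s \<in> K" unfolding s_def using K AK C by (intro subspace_sum subspace_mul) auto
      have "w \<bullet> s = 0" if "w \<in> K" for w
      proof -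
        have "w \<bullet> s = quad A cc v w - (v \<bullet> a0) * (w \<bullet> (\<Sum>a\<in>C. c a *\<^sub>R a))"
          by (simp add: s_def f_def quad_cc inner_sum_right sum_distrib_left sum_subtractf algebra_simps)
        then show ?thesis using c(3) \<open>\<And>w. w \<in> K \<Longrightarrow> quad A cc v w = 0\<close>[OF that] by simp
      qed
      then have "s = 0" using \<open>s \<in> K\<close> inner_eq_zero_iff by blast
      moreover have "(\<Sum>a\<in>C. f a) = 0"
      proof -
        have "(\<Sum>a\<in>C. f a) = v \<bullet> (\<Sum>a\<in>C. c a *\<^sub>R a) - (\<Sum>a\<in>C. c a) * (v \<bullet> a0)"
          by (simp add: f_def inner_sum_right sum_distrib_right sum_subtractf right_diff_distrib)
        then show ?thesis using c by simp
      qed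
      ultimately have "f a = 0" using vanish[of f a0 a] a0 a by (simp add: s_def f_def)
      then show "v \<bullet> a = v \<bullet> a0" using c0[OF a] by (simp add: f_def)
    qed
    have kernel': "quad A cc v w = 0" if "v \<in> K'" for v w
    proof -
      have "quad A cc v w = (v \<bullet> a0) * (w \<bullet> (\<Sum>a\<in>C. c a *\<^sub>R a))"
        by (auto simp: quad_cc inner_sum_right sum_distrib_left const[OF that] intro!: sum.cong)
      then show ?thesis using c(3) by simp
    qed
    \<comment> \<open>\<open>K'\<close> is the radical of \<open>cc\<close>, and there
      \<open>c2\<close> gives the nondegenerate form of the induction hypothesis.\<close>
    have "\<exists>e. \<forall>v\<in>K. (\<forall>w\<in>K. quad A (\<lambda>a. cc a + e * c2 a) v w = 0) \<longrightarrow> v = 0"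
    proof (rule quad_perturb[OF K])
      fix v assume v: "v \<in> K" "\<And>w. w \<in> K \<Longrightarrow> quad A cc v w = 0"
        "\<And>w. w \<in> K \<Longrightarrow> (\<And>u. u \<in> K \<Longrightarrow> quad A cc w u = 0) \<Longrightarrow> quad A c2 v w = 0"
      have vK': "v \<in> K'" using kernel v(1,2) by blast
      have "quad (pr ` A) c' v w = 0" if "w \<in> K'" for w
        using v(3)[of w] kernel'[OF that] c2_3[OF vK' that] that by (auto simp: K'_def)
      then show "v = 0" using c'(3) vK' by blast
    qed
    then obtain e where e: "\<forall>v\<in>K. (\<forall>w\<in>K. quad A (\<lambda>a. cc a + e * c2 a) v w = 0) \<longrightarrow> v = 0"
      by blast
    have "(\<Sum>a\<in>A. cc a + e * c2 a) = 0"
      using cc[of "\<lambda>_. 1::real"] c(1) c2_1 by (simp add: sum.distrib flip: sum_distrib_left)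
    moreover have "(\<Sum>a\<in>A. (cc a + e * c2 a) *\<^sub>R a) = 0"
      using cc[of "\<lambda>a. a"] c(3) c2_2
      by (simp add: scaleR_left_distrib sum.distrib flip: scaleR_scaleR scaleR_sum_right)
    ultimately show ?thesis using e by blast
  qed
qed

section \<open>Algebraic relations and homogeneous components\<close>

lemma entire_mult_eq_0:
  assumes "F holomorphic_on UNIV" "G holomorphic_on UNIV" "\<And>s. F s * G s = 0"
  shows "(\<forall>s. F s = 0) \<or> (\<forall>s. G s = (0::complex))"
proof (rule ccontr)
  assume n: "\<not> ?thesis"
  have "open (F -` (- {0}))"
    using assms(1) by (intro open_vimage holomorphic_on_imp_continuous_on) auto
  moreover have "F -` (- {0}) \<noteq> {}" using n by auto
  moreover have "G z = 0" if "z \<in> F -` (- {0})" for z using assms(3)[of z] that by auto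
  ultimately have "G s = 0" for s
    using analytic_continuation_open[of "F -` (- {0})" UNIV G "\<lambda>_. 0" s] assms(2) connected_UNIV by simp
  then show False using n by blast
qed

section \<open>Algebraic dependence by counting monomials\<close>

lemma monomials_independent:
  assumes "finite A" "\<And>c :: 'x \<Rightarrow> complex. (\<Sum>m\<in>PiE A (\<lambda>_. {..E}). k m * (\<Prod>a\<in>A. c a ^ m a)) = 0"
    "m \<in> PiE A (\<lambda>_. {..E :: nat})"
  shows "k m = 0"
  using assms
proof (induction A arbitrary: k m rule: finite_induct)
  case empty
  then show ?case by (simp add: PiE_empty_domain)
next
  case (insert x A)
  let ?B = "PiE A (\<lambda>_. {..E})"
  have fin: "finite ?B" using insert by (intro finite_PiE) auto
  have inj: "inj_on (\<lambda>(y, g). g(x := y)) ({..E} \<times> ?B)"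
  proof (rule inj_onI, clarsimp)
    fix y y' and g g' :: "'x \<Rightarrow> nat"
    assume g: "g \<in> ?B" "g' \<in> ?B" and eq: "g(x := y) = g'(x := y')"
    \<comment> \<open>Extensional functions have the default value at \<open>x\<close>, so the
      update at \<open>x\<close> loses no information.\<close>
    have "g x = undefined" "g' x = undefined" using g insert by (auto simp: PiE_def extensional_def)
    then show "y = y' \<and> g = g'" using eq by (metis fun_upd_same fun_upd_triv fun_upd_upd)
  qed
  have split: "(\<Sum>m\<in>PiE (insert x A) (\<lambda>_. {..E}). k m * (\<Prod>a\<in>insert x A. c a ^ m a)) =
    (\<Sum>y\<le>E. (\<Sum>g\<in>?B. k (g(x := y)) * (\<Prod>a\<in>A. c a ^ g a)) * c x ^ y)" for c :: "'x \<Rightarrow> complex"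
  proof -
    have p: "(\<Prod>a\<in>insert x A. c a ^ (g(x := y)) a) = c x ^ y * (\<Prod>a\<in>A. c a ^ g a)" for g y
    proof -
      have "(\<Prod>a\<in>A. c a ^ (g(x := y)) a) = (\<Prod>a\<in>A. c a ^ g a)"
        using insert.hyps by (intro prod.cong) auto
      then show ?thesis using insert.hyps by simp
    qed
    have "(\<Sum>m\<in>PiE (insert x A) (\<lambda>_. {..E}). k m * (\<Prod>a\<in>insert x A. c a ^ m a)) =
      (\<Sum>(y, g)\<in>{..E} \<times> ?B. k (g(x := y)) * (\<Prod>a\<in>insert x A. c a ^ (g(x := y)) a))"
      unfolding PiE_insert_eq by (subst sum.reindex[OF inj]) (simp add: case_prod_unfold)
    also have "\<dots> = (\<Sum>y\<le>E. \<Sum>g\<in>?B. k (g(x := y)) * (\<Prod>a\<in>A. c a ^ g a) * c x ^ y)"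
      unfolding p by (simp add: sum.cartesian_product mult_ac)
    finally show ?thesis by (simp add: sum_distrib_right)
  qed
  have "(\<Sum>g\<in>?B. k (g(x := y)) * (\<Prod>a\<in>A. c a ^ g a)) = 0" if "y \<le> E" for c y
  proof (rule zero_polynom_imp_zero_coeffs[OF _ that])
    fix t :: complex
    have "(\<Prod>a\<in>A. (c(x := t)) a ^ g a) = (\<Prod>a\<in>A. c a ^ g a)" for g
      using insert by (intro prod.cong) auto
    then show "(\<Sum>y\<le>E. (\<Sum>g\<in>?B. k (g(x := y)) * (\<Prod>a\<in>A. c a ^ g a)) * t ^ y) = 0"
      using insert.prems(1)[of "c(x := t)"] unfolding split by simp
  qed
  then have *: "k (g(x := y)) = 0" if "y \<le> E" "g \<in> ?B" for y g
    using insert.IH[of "\<lambda>g. k (g(x := y))"] that by blast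
  obtain y g where "y \<le> E" "g \<in> ?B" "m = g(x := y)"
    using insert.prems(2) by (auto simp: PiE_insert_eq)
  then show ?case using * by blast
qed

interpretation funspace: vector_space "\<lambda>(c::complex) (f :: 'y \<Rightarrow> complex) y. c * f y"
  by unfold_locales (auto simp: fun_eq_iff algebra_simps)

text \<open>Repeated functions are invisible in the image set, so they are treated separately, with
  coefficients 1 and -1.\<close>

lemma ex_linear_relation:
  fixes \<Psi> :: "'m \<Rightarrow> 'y \<Rightarrow> complex"
  assumes "finite M" "finite T" "\<Psi> ` M \<subseteq> funspace.span T" "card T < card M"
  shows "\<exists>k. (\<exists>m\<in>M. k m \<noteq> 0) \<and> (\<forall>y. (\<Sum>m\<in>M. k m * \<Psi> m y) = 0)"
proof (cases "inj_on \<Psi> M")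
  case False
  then obtain m n where mn: "m \<in> M" "n \<in> M" "\<Psi> m = \<Psi> n" "m \<noteq> n" by (auto simp: inj_on_def)
  define k :: "'m \<Rightarrow> complex" where "k = (\<lambda>_. 0)(m := 1, n := -1)"
  have "(\<Sum>i\<in>M. k i * \<Psi> i y) = (\<Sum>i\<in>{m, n}. k i * \<Psi> i y)" for y
    using mn assms(1) by (intro sum.mono_neutral_right) (auto simp: k_def)
  then show ?thesis using mn by (intro exI[of _ k]) (auto simp: k_def)
next
  case True
  have "\<not> funspace.independent (\<Psi> ` M)"
    using funspace.independent_span_bound[OF assms(2) _ assms(3)] assms(4) card_image[OF True] by auto
  then obtain u where u: "\<exists>v\<in>\<Psi> ` M. u v \<noteq> 0" "(\<Sum>v\<in>\<Psi> ` M. (\<lambda>y. u v * v y)) = 0"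
    using funspace.dependent_finite[of "\<Psi> ` M"] assms(1) by auto
  show ?thesis
  proof (intro exI[of _ "u \<circ> \<Psi>"] conjI allI)
    fix y
    have "(\<Sum>m\<in>M. (u \<circ> \<Psi>) m * \<Psi> m y) = (\<Sum>v\<in>\<Psi> ` M. (\<lambda>y. u v * v y)) y"
      by (simp add: sum_fun_apply sum.reindex[OF True])
    then show "(\<Sum>m\<in>M. (u \<circ> \<Psi>) m * \<Psi> m y) = 0" using u(2) by simp
  qed (use u in auto)
qed

lemma span_mult:
  assumes "f \<in> funspace.span S" "g \<in> funspace.span T"
    "\<And>s t. s \<in> S \<Longrightarrow> t \<in> T \<Longrightarrow> s * t \<in> funspace.span U"
  shows "f * g \<in> funspace.span U"
proof -
  have 1: "s * g \<in> funspace.span U" if "s \<in> S" for s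
  proof (rule funspace.span_induct[OF assms(2)])
    show "funspace.subspace {g. s * g \<in> funspace.span U}"
    proof (rule funspace.subspaceI, goal_cases)
      case 1
      then show ?case by (simp add: funspace.span_zero)
    next
      case (2 x y)
      then show ?case by (simp add: distrib_left funspace.span_add)
    next
      case (3 k x)
      have eq: "s * (\<lambda>y. k * x y) = (\<lambda>y. k * (s * x) y)" by auto
      show ?case using 3 funspace.span_scale[of "s * x" U k] unfolding mem_Collect_eq eq by blast
    qed
  qed (blast intro: assms(3) that)
  show ?thesis
  proof (rule funspace.span_induct[OF assms(1)])
    show "funspace.subspace {f. f * g \<in> funspace.span U}"
    proof (rule funspace.subspaceI, goal_cases)
      case 1
      then show ?case by (simp add: funspace.span_zero)
    next
      case (2 x y)
      then show ?case by (simp add: distrib_right funspace.span_add)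
    next
      case (3 k x)
      have eq: "(\<lambda>y. k * x y) * g = (\<lambda>y. k * (x * g) y)" by auto
      show ?case using 3 funspace.span_scale[of "x * g" U k] unfolding mem_Collect_eq eq by blast
    qed
  qed (blast intro: 1)
qed

text \<open>\<open>N\<close> functions that are products of linear forms in \<open>n\<close> variables with characters of
  \<open>d\<close> variables are algebraically dependent as soon as \<open>n + d < N\<close>, by counting monomials.\<close>

lemma ex_algebraic_relation:
  fixes F :: "'f set" and chr :: "int ^ 'k::finite \<Rightarrow> ('k \<Rightarrow> complex) \<Rightarrow> complex"
  assumes fin: "finite A" "finite F" and card: "card F + CARD('k) < card A"
    and chr: "\<And>a x. chr a x = exp (\<Sum>i\<in>UNIV. of_int (a $ i) * x i)"
  shows "\<exists>p\<in>polyfun A. p \<noteq> 0 \<and>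
    (\<forall>w x. p (\<lambda>a. (\<Sum>f\<in>F. L a f * w f) * chr a x) = 0)"
proof -
  define N where "N = card A"
  have N: "N > 0" using card by (simp add: N_def)
  \<comment> \<open>A bound for the exponents in \<open>A\<close>; the successor makes it
    positive.\<close>
  define R :: nat where "R = Suc (\<Sum>a\<in>A. \<Sum>i\<in>UNIV. nat \<bar>a $ i\<bar>)"
  have R: "\<bar>a $ i\<bar> \<le> int R" if "a \<in> A" for a i
  proof -
    have "nat \<bar>a $ i\<bar> \<le> (\<Sum>i\<in>UNIV. nat \<bar>a $ i\<bar>)" by (rule member_le_sum) auto
    also have "\<dots> \<le> (\<Sum>a\<in>A. \<Sum>i\<in>UNIV. nat \<bar>a $ i\<bar>)" by (rule member_le_sum) (use that fin in auto)
    finally have "nat \<bar>a $ i\<bar> \<le> R" by (simp add: R_def)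
    then show ?thesis by linarith
  qed
  define G where "G n e = (\<lambda>(w :: 'f \<Rightarrow> complex, x :: 'k \<Rightarrow> complex). (\<Prod>f\<in>F. w f ^ n f) * exp (\<Sum>i\<in>UNIV. of_int (e i) * x i))"
    for n :: "'f \<Rightarrow> nat" and e :: "'k \<Rightarrow> int"
  define idx where "idx D = PiE F (\<lambda>_. {..D}) \<times> PiE UNIV (\<lambda>_::'k. {- int (R * D)..int (R * D)})" for D
  define T where "T D = (\<lambda>(n, e). G n e) ` idx D" for D
  have T_I: "G n e \<in> T D" if "\<And>f. f \<in> F \<Longrightarrow> n f \<le> D" "\<And>i. \<bar>e i\<bar> \<le> int (R * D)" for n e D
  proof -
    have "G n e = G (restrict n F) e" by (auto simp: G_def intro!: prod.cong)
    moreover have "(restrict n F, e) \<in> idx D" using that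
      by (auto simp: idx_def abs_le_iff minus_le_iff)
    ultimately show ?thesis unfolding T_def by (metis (mono_tags, lifting) case_prod_conv image_eqI)
  qed
  have T_mult: "s * t \<in> T (D + D')" if st: "s \<in> T D" "t \<in> T D'" for s t D D'
  proof -
    obtain n e n' e' where *: "s = G n e" "t = G n' e'" "(n, e) \<in> idx D" "(n', e') \<in> idx D'"
      using st by (auto simp: T_def)
    have "s * t = G (\<lambda>f. n f + n' f) (\<lambda>i. e i + e' i)"
    proof
      fix y :: "('f \<Rightarrow> complex) \<times> ('k \<Rightarrow> complex)"
      obtain w x where "y = (w, x)" by fastforce
      then show "(s * t) y = G (\<lambda>f. n f + n' f) (\<lambda>i. e i + e' i) y"
        by (simp only: * G_def times_fun_apply case_prod_conv power_add prod.distrib distrib_right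
            sum.distrib exp_add of_int_add) (simp only: mult_ac)
    qed
    also have "\<dots> \<in> T (D + D')"
    proof (rule T_I)
      show "\<bar>e i + e' i\<bar> \<le> int (R * (D + D'))" for i
      proof -
        have "e i \<in> {- int (R * D)..int (R * D)}" "e' i \<in> {- int (R * D')..int (R * D')}"
          using * by (auto simp: idx_def PiE_iff)
        then show ?thesis by (auto simp: algebra_simps)
      qed
    qed (use * in \<open>force simp: idx_def PiE_iff intro: add_mono\<close>)
    finally show ?thesis .
  qed
  \<comment> \<open>A filtration: indices add under multiplication, and each \<open>Fn a\<close> has
    index one.\<close>
  define V where "V D = funspace.span (T D)" for D
  have V_mult: "f * g \<in> V (D + D')" if "f \<in> V D" "g \<in> V D'" for f g D D'
    unfolding V_def by (rule span_mult[OF that[unfolded V_def]]) (intro funspace.span_base T_mult)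
  have V_one: "1 \<in> V D" for D
  proof -
    have "1 = G (\<lambda>_. 0) (\<lambda>_. 0)" by (auto simp: G_def fun_eq_iff)
    also have "\<dots> \<in> V D" unfolding V_def by (intro funspace.span_base T_I) auto
    finally show ?thesis .
  qed
  define Fn where "Fn a = (\<lambda>(w, x). (\<Sum>f\<in>F. L a f * w f) * chr a x)" for a
  have Fn: "Fn a \<in> V 1" if "a \<in> A" for a
  proof -
    have "Fn a = (\<Sum>f\<in>F. (\<lambda>y. L a f * G (\<lambda>g. if g = f then 1 else 0) (\<lambda>i. a $ i) y))"
    proof
      fix y
      have "(\<Prod>g\<in>F. w g ^ (if g = f then 1 else 0)) = w f" if "f \<in> F" for f and w :: "'f \<Rightarrow> complex"
        using that fin(2) by (simp add: if_distrib[of "\<lambda>n. _ ^ n"] cong: if_cong)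
      then show "Fn a y = (\<Sum>f\<in>F. (\<lambda>y. L a f * G (\<lambda>g. if g = f then 1 else 0) (\<lambda>i. a $ i) y)) y"
        by (auto simp: Fn_def G_def chr sum_fun_apply sum_distrib_right case_prod_unfold mult.assoc
            intro!: sum.cong)
    qed
    also have "\<dots> \<in> V 1" unfolding V_def
      by (intro funspace.span_sum funspace.span_scale funspace.span_base T_I) (use R that in auto)
    finally show ?thesis .
  qed
  have prod: "(\<Prod>a\<in>S. Fn a ^ m a) \<in> V (\<Sum>a\<in>S. m a)" if "S \<subseteq> A" for S m
  proof -
    have "finite S" using that fin finite_subset by blast
    then show ?thesis using that
    proof (induction S rule: finite_induct)
      case (insert a S)
      have "Fn a ^ n \<in> V n" for n
        using V_mult[OF Fn, of a _ ] insert.prems V_one[of 0]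
        by (induction n) auto
      moreover have "(\<Prod>a\<in>S. Fn a ^ m a) \<in> V (\<Sum>a\<in>S. m a)" using insert by blast
      ultimately have "Fn a ^ m a * (\<Prod>a\<in>S. Fn a ^ m a) \<in> V (m a + (\<Sum>a\<in>S. m a))"
        by (rule V_mult)
      then show ?case by (simp only: prod.insert[OF insert.hyps(1,2)] sum.insert[OF insert.hyps(1,2)])
    qed (simp add: V_one)
  qed
  have V_mono: "V D \<subseteq> V D'" if "D \<le> D'" for D D'
  proof
    fix f assume "f \<in> V D"
    then have "f * 1 \<in> V (D + (D' - D))" by (rule V_mult[OF _ V_one])
    then show "f \<in> V D'" using that by (simp only: mult_1_right le_add_diff_inverse)
  qed
  \<comment> \<open>The \<open>(E + 1) ^ N\<close> monomials with exponents at most \<open>E\<close>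
    have total degree at most \<open>N * E\<close>. The functions spanning their values number at
    most \<open>(2 * R * N * (E + 1)) ^ (N - 1)\<close>, and this \<open>E\<close> turns the bound
    into \<open>E * (E + 1) ^ (N - 1)\<close>.\<close>
  define E where "E = (2 * R * N) ^ (N - 1)"
  define M where "M = PiE A (\<lambda>_. {..E})"
  have "card (T (N * E)) \<le> (N * E + 1) ^ card F * (2 * R * (N * E) + 1) ^ CARD('k)"
  proof -
    have "card (T (N * E)) \<le> card (idx (N * E))"
      unfolding T_def by (rule card_image_le) (unfold idx_def, intro finite_cartesian_product finite_PiE fin; simp)
    also have "\<dots> = (N * E + 1) ^ card F * (2 * R * (N * E) + 1) ^ CARD('k)"
    proof -
      have "card {- int n..int n} = 2 * n + 1" for n by simp
      then show ?thesis
        by (simp only: idx_def card_cartesian_product card_PiE[OF fin(2)] card_PiE[OF finite_class.finite_UNIV]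
            prod_constant card_atMost Suc_eq_plus1 mult.assoc)
    qed
    finally show ?thesis .
  qed
  also have "\<dots> \<le> (2 * R * N * (E + 1)) ^ card F * (2 * R * N * (E + 1)) ^ CARD('k)"
  proof (intro mult_mono power_mono)
    have "1 \<le> R * N" using N by (simp add: R_def)
    then show "2 * R * (N * E) + 1 \<le> 2 * R * N * (E + 1)" by (simp add: algebra_simps)
    have "N * E + 1 \<le> N * (E + 1)" using N by simp
    also have "\<dots> \<le> (2 * R) * (N * (E + 1))" by (simp add: R_def)
    finally show "N * E + 1 \<le> 2 * R * N * (E + 1)" by (simp only: mult.assoc)
  qed simp_all
  also have "\<dots> = (2 * R * N * (E + 1)) ^ (card F + CARD('k))" by (rule power_add[symmetric])
  also have "\<dots> \<le> (2 * R * N * (E + 1)) ^ (N - 1)"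
  proof (rule power_increasing)
    show "card F + CARD('k) \<le> N - 1" using card by (simp add: N_def)
    have "R \<ge> 1" by (simp add: R_def)
    then have "0 < 2 * R * N * (E + 1)" using N by simp
    then show "1 \<le> 2 * R * N * (E + 1)" by (simp only: One_nat_def Suc_le_eq)
  qed
  also have "\<dots> = E * (E + 1) ^ (N - 1)" by (subst power_mult_distrib) (simp only: E_def[symmetric])
  also have "\<dots> < (E + 1) * (E + 1) ^ (N - 1)" by simp
  also have "\<dots> = (E + 1) ^ N" using N by (cases N) simp_all
  also have "\<dots> = card M" by (simp add: M_def card_PiE[OF fin(1)] N_def)
  finally have less: "card (T (N * E)) < card M" .
  have "(\<lambda>m. \<Prod>a\<in>A. Fn a ^ m a) ` M \<subseteq> funspace.span (T (N * E))"
  proof clarify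
    fix m assume "m \<in> M"
    then have "(\<Sum>a\<in>A. m a) \<le> N * E"
      unfolding N_def M_def by (intro sum_bounded_above[of A m E, simplified]) (auto simp: PiE_iff)
    then show "(\<Prod>a\<in>A. Fn a ^ m a) \<in> funspace.span (T (N * E))"
      using prod[of A m] V_mono unfolding V_def by blast
  qed
  moreover have "finite (T (N * E))" 
    unfolding T_def idx_def by (intro finite_imageI finite_cartesian_product finite_PiE fin; simp)
  moreover have "finite M" unfolding M_def by (intro finite_PiE fin) auto
  ultimately obtain k m where k: "m \<in> M" "k m \<noteq> 0" "\<And>y. (\<Sum>m\<in>M. k m * (\<Prod>a\<in>A. Fn a ^ m a) y) = 0"
    using ex_linear_relation[of M "T (N * E)" "\<lambda>m. \<Prod>a\<in>A. Fn a ^ m a"] less by auto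
  define p where "p c = (\<Sum>m\<in>M. k m * (\<Prod>a\<in>A. c a ^ m a))" for c
  have prod_apply: "(\<Prod>a\<in>S. H a) y = (\<Prod>a\<in>S. H a y)" for S and H :: "(int ^ 'k) \<Rightarrow> 'z \<Rightarrow> complex" and y
    by (induction S rule: infinite_finite_induct) auto
  show ?thesis
  proof (intro bexI[of _ p] conjI allI)
    show "p \<in> polyfun A" unfolding p_def
      by (intro polyfun_sum polyfun_mult polyfun_const polyfun_prod polyfun_power polyfun_var)
    show "p \<noteq> 0"
    proof
      assume "p = 0"
      then have "(\<Sum>m\<in>PiE A (\<lambda>_. {..E}). k m * (\<Prod>a\<in>A. c a ^ m a)) = 0" for c
        by (simp add: fun_eq_iff p_def M_def)
      from monomials_independent[OF fin(1) this] k show False by (auto simp: M_def)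
    qed
    show "p (\<lambda>a. (\<Sum>f\<in>F. L a f * w f) * chr a x) = 0" for w x
      using k(3)[of "(w, x)"] by (simp add: p_def prod_apply power_fun_apply Fn_def)
  qed
qed

text \<open>All iterated derivatives of \<open>g\<close> stay in \<open>J\<close> and vanish at
  \<open>z\<close>, which kills the Taylor expansion there. On a line through \<open>z\<close>,
  differentiation lowers the degree and again gives the restriction of an element of
  \<open>J\<close>.\<close>

lemma polyfun_zero_if_gradient_closed:
  assumes "finite A" "J \<subseteq> polyfun A" and z: "\<And>g. g \<in> J \<Longrightarrow> g z = 0"
    and lin: "0 \<in> J" "\<And>f g. f \<in> J \<Longrightarrow> g \<in> J \<Longrightarrow> f + g \<in> J" "\<And>k f. f \<in> J \<Longrightarrow> (\<lambda>c. k * f c) \<in> J"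
    and grad: "\<And>g. g \<in> J \<Longrightarrow> \<exists>G. (\<forall>a\<in>A. G a \<in> J) \<and>
      (\<forall>\<gamma> \<gamma>' s. (\<forall>a\<in>A. ((\<lambda>s. \<gamma> s a) has_field_derivative \<gamma>' a) (at s)) \<longrightarrow>
       ((\<lambda>s. g (\<gamma> s)) has_field_derivative (\<Sum>a\<in>A. G a (\<gamma> s) * \<gamma>' a)) (at s))"
    and "g \<in> J"
  shows "g = 0"
proof
  fix c
  define \<gamma> where "\<gamma> s = (\<lambda>a. z a + s * (c a - z a))" for s
  have "q = 0" if "g \<in> J" "\<And>s. g (\<gamma> s) = poly q s" for g q
    using that
  proof (induction "degree q" arbitrary: g q rule: less_induct)
    case less
    have const: "q = 0" if d0: "degree q = 0"
    proof -
      obtain k where "q = [:k:]" using d0 by (auto elim: degree_eq_zeroE)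
      moreover have "poly q 0 = 0" using less.prems(2)[of 0] z[OF less.prems(1)] by (simp add: \<gamma>_def)
      ultimately show ?thesis by simp
    qed
    obtain G where G: "\<And>a. a \<in> A \<Longrightarrow> G a \<in> J"
      "\<And>\<gamma> \<gamma>' s. (\<And>a. a \<in> A \<Longrightarrow> ((\<lambda>s. \<gamma> s a) has_field_derivative \<gamma>' a) (at s)) \<Longrightarrow>
       ((\<lambda>s. g (\<gamma> s)) has_field_derivative (\<Sum>a\<in>A. G a (\<gamma> s) * \<gamma>' a)) (at s)"
      using grad[OF less.prems(1)] by blast
    define D where "D = (\<Sum>a\<in>A. (\<lambda>x. (c a - z a) * G a x))"
    have "S \<subseteq> A \<Longrightarrow> (\<Sum>a\<in>S. (\<lambda>x. (c a - z a) * G a x)) \<in> J" for S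
      by (induction S rule: infinite_finite_induct) (auto intro!: lin G)
    then have "D \<in> J" by (simp add: D_def)
    moreover have "D (\<gamma> s) = poly (pderiv q) s" for s
    proof (rule DERIV_unique)
      have "((\<lambda>s. g (\<gamma> s)) has_field_derivative (\<Sum>a\<in>A. G a (\<gamma> s) * (c a - z a))) (at s)"
        by (rule G(2)) (auto simp: \<gamma>_def intro!: derivative_eq_intros)
      then show "(poly q has_field_derivative D (\<gamma> s)) (at s)"
        by (simp add: less.prems(2) D_def sum_fun_apply mult.commute)
    qed (rule poly_DERIV)
    ultimately have "pderiv q = 0" if "degree q \<noteq> 0"
      using less.hyps[of "pderiv q" D] that by (simp add: degree_pderiv)
    then show ?case using const by (auto simp: pderiv_eq_0_iff)
  qed
  moreover obtain q where q: "\<And>s. g (\<gamma> s) = poly q s"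
    using polyfun_line[of g A z "\<lambda>a. c a - z a"] \<open>g \<in> J\<close> assms(2) unfolding \<gamma>_def by blast
  ultimately have "q = 0" using \<open>g \<in> J\<close> by blast
  then show "g c = 0 c" using q[of 1] by (simp add: \<gamma>_def)
qed

text \<open>The coefficients of \<open>p (t * c)\<close> in \<open>t\<close> are the homogeneous
  components of \<open>p\<close>, and on a cone they vanish together with \<open>p\<close>.\<close>

lemma homogeneous_component:
  assumes "p \<in> polyfun A" "p \<noteq> 0"
    and cone: "\<And>z. z \<in> Z \<Longrightarrow> p z = 0" "\<And>z t. z \<in> Z \<Longrightarrow> (\<lambda>a. t * z a) \<in> Z"
  obtains h n where "h \<in> polyfun A" "h \<noteq> 0" "\<And>z. z \<in> Z \<Longrightarrow> h z = 0"
    "\<And>t c. h (\<lambda>a. t * c a) = t ^ n * h c"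
proof -
  obtain P where P: "P \<in> polys_over (polyfun A)" "\<And>c t. p (\<lambda>a. 0 + t * c a) = poly P (\<lambda>_. t) c"
    by (rule polyfun_expand[OF assms(1), of "\<lambda>_ _. 0" A "\<lambda>a c. c a"])
      (auto intro: polyfun_const polyfun_var)
  have P': "poly (eval_coeffs P c) t = p (\<lambda>a. t * c a)" for c t
    using P(2)[of t c] poly_eval_coeffs[of P c "\<lambda>_. t"] by simp
  obtain c where c: "p c \<noteq> 0" using assms(2) by (auto simp: fun_eq_iff)
  then have "eval_coeffs P c \<noteq> 0" using P'[of c 1] by auto
  then obtain n where n: "coeff P n c \<noteq> 0" by (auto simp: poly_eq_iff)
  show ?thesis
  proof
    show "coeff P n \<in> polyfun A" using P by (auto simp: polys_over_def)
    show "coeff P n \<noteq> 0" using n by auto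
    fix z assume "z \<in> Z"
    then have "poly (eval_coeffs P z) t = 0" for t using cone by (simp add: P')
    then have "eval_coeffs P z = 0" using poly_all_0_iff_0 by blast
    then show "coeff P n z = 0" by (metis coeff_0 coeff_eval_coeffs)
  next
    fix t c
    have "poly (eval_coeffs P (\<lambda>a. t * c a)) s = poly (pcompose (eval_coeffs P c) [:0, t:]) s" for s
    proof -
      have "(\<lambda>a. s * (t * c a)) = (\<lambda>a. poly [:0, t:] s * c a)" by (simp add: fun_eq_iff)
      then show ?thesis by (simp only: P' poly_pcompose)
    qed
    then have "eval_coeffs P (\<lambda>a. t * c a) = pcompose (eval_coeffs P c) [:0, t:]"
      using poly_eq_poly_eq_iff by blast
    then have "coeff (eval_coeffs P (\<lambda>a. t * c a)) n = coeff (pcompose (eval_coeffs P c) [:0, t:]) n" by simp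
    then show "coeff P n (\<lambda>a. t * c a) = t ^ n * coeff P n c"
      by (simp add: coeff_pcompose_linear)
  qed
qed

text \<open>For nonzero \<open>t\<close>, \<open>h (c + t * w0) = t ^ n * h (w0 + c / t)\<close>. So
  the coefficient of \<open>t ^ n\<close> is \<open>h w0\<close>, and no higher power
  occurs.\<close>

lemma homogeneous_monic:
  assumes h: "h \<in> polyfun A" "\<And>t c. h (\<lambda>a. t * c a) = t ^ n * h c" "h w0 = 1"
  obtains P where "P \<in> polys_over (polyfun A)" "lead_coeff P = 1"
    "\<And>c t. h (\<lambda>a. c a + t * w0 a) = poly P (\<lambda>_. t) c"
proof -
  obtain P where P: "P \<in> polys_over (polyfun A)" "\<And>c t. h (\<lambda>a. c a + t * w0 a) = poly P (\<lambda>_. t) c"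
    by (rule polyfun_expand[OF h(1), of "\<lambda>a c. c a" A "\<lambda>a _. w0 a", OF polyfun_var polyfun_const]) blast+
  have co: "coeff P j c = (if j = n then 1 else 0)" if "j \<ge> n" for j c
  proof -
    obtain r where r: "\<And>s. h (\<lambda>a. w0 a + s * c a) = poly r s"
      using polyfun_line[OF h(1), of w0 c] by blast
    define d where "d = degree r"
    \<comment> \<open>The factor \<open>t ^ d\<close> clears the denominators of
      \<open>r (1 / t)\<close>, and \<open>[:0, 1:]\<close> makes the identity trivial at
      \<open>t = 0\<close>.\<close>
    have "monom 1 n * reflect_poly r * [:0, 1:] = monom 1 d * eval_coeffs P c * [:0, 1:]"
    proof (rule poly_eq_poly_eq_iff[THEN iffD1], rule ext)
      fix t
      show "poly (monom 1 n * reflect_poly r * [:0, 1:]) t = poly (monom 1 d * eval_coeffs P c * [:0, 1:]) t"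
      proof (cases "t = 0")
        case False
        have e: "(\<lambda>a. t * (w0 a + inverse t * c a)) = (\<lambda>a. c a + t * w0 a)"
          using False by (intro ext) (simp add: distrib_left)
        have "poly (eval_coeffs P c) t = poly P (\<lambda>_. t) c" by (rule poly_eval_coeffs[of P c "\<lambda>_. t"])
        also have "\<dots> = h (\<lambda>a. c a + t * w0 a)" by (rule P(2)[symmetric])
        also have "\<dots> = h (\<lambda>a. t * (w0 a + inverse t * c a))" by (simp only: e)
        also have "\<dots> = t ^ n * poly r (inverse t)" by (simp only: h(2) r)
        finally show ?thesis
          using False by (simp add: poly_monom poly_reflect_poly_nz d_def)
      qed simp
    qed
    then have "monom 1 n * reflect_poly r = monom 1 d * eval_coeffs P c" by simp
    from arg_cong[OF this, of "\<lambda>q. coeff q (d + j)"]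
    have "coeff P j c = coeff (reflect_poly r) (d + j - n)"
      using that by (simp add: coeff_monom_mult)
    also have "\<dots> = (if j = n then coeff r 0 else 0)"
      using that by (auto simp: coeff_reflect_poly d_def)
    also have "coeff r 0 = 1" using r[of 0] h(3) by (simp add: poly_0_coeff_0)
    finally show ?thesis .
  qed
  have "degree P = n"
    by (intro antisym degree_le le_degree) (auto simp: fun_eq_iff co)
  then have "lead_coeff P = 1" by (simp add: fun_eq_iff co)
  then show ?thesis using that P by blast
qed

section \<open>The ideal of the discriminant\<close>

definition pair :: "int ^ 'k::finite \<Rightarrow> ('k \<Rightarrow> complex) \<Rightarrow> complex" where
  "pair a x = (\<Sum>i\<in>UNIV. of_int (a $ i) * x i)"

definition affine_relations :: "(int ^ 'k::finite) set \<Rightarrow> (int ^ 'k \<Rightarrow> complex) set" where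
  "affine_relations A = {w. (\<Sum>a\<in>A. w a) = 0 \<and> (\<forall>i. (\<Sum>a\<in>A. w a * of_int (a $ i)) = 0)}"

definition torus_act :: "(int ^ 'k::finite \<Rightarrow> complex) \<Rightarrow> ('k \<Rightarrow> complex) \<Rightarrow> int ^ 'k \<Rightarrow> complex" where
  "torus_act w x = (\<lambda>a. w a * exp (pair a x))"

text \<open>\<open>torus_act w x\<close> is singular at \<open>y = exp (- x)\<close> exactly if \<open>w\<close> is singular at \<open>(1, \<dots>, 1)\<close>,
  that is, if \<open>w\<close> is an affine relation.\<close>

definition singular_points :: "(int ^ 'k::finite) set \<Rightarrow> (int ^ 'k \<Rightarrow> complex) set" where
  "singular_points A = {torus_act w x |w x. w \<in> affine_relations A}"

definition hessian :: "(int ^ 'k::finite) set \<Rightarrow> (int ^ 'k \<Rightarrow> complex) \<Rightarrow> complex ^ 'k ^ 'k" where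
  "hessian A w = (\<chi> i j. \<Sum>a\<in>A. w a * of_int (a $ i) * of_int (a $ j))"

text \<open>A substitute for holomorphy in several variables. Complex lines suffice, because any two
  parameter points lie on one.\<close>

definition entire_on_lines :: "(('a \<Rightarrow> complex) \<Rightarrow> ('b \<Rightarrow> complex) \<Rightarrow> complex) \<Rightarrow> bool" where
  "entire_on_lines \<Phi> \<longleftrightarrow> (\<forall>w w' x x'.
     (\<lambda>s. \<Phi> (\<lambda>a. w a + s * w' a) (\<lambda>i. x i + s * x' i)) holomorphic_on UNIV)"

section \<open>Entire functions on the parameter space\<close>

lemma affine_relations_line:
  assumes "w \<in> affine_relations A" "w' \<in> affine_relations A"
  shows "(\<lambda>a. w a + s * w' a) \<in> affine_relations A"
proof -
  have "(\<Sum>a\<in>A. (w a + s * w' a) * of_int (a $ i)) =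
      (\<Sum>a\<in>A. w a * of_int (a $ i)) + s * (\<Sum>a\<in>A. w' a * of_int (a $ i))" for i
    by (simp add: sum_distrib_left sum.distrib algebra_simps)
  moreover have "(\<Sum>a\<in>A. w a + s * w' a) = (\<Sum>a\<in>A. w a) + s * (\<Sum>a\<in>A. w' a)"
    by (simp add: sum_distrib_left sum.distrib)
  ultimately show ?thesis using assms by (simp only: affine_relations_def mem_Collect_eq) simp
qed

lemma affine_relations_diff:
  assumes "w \<in> affine_relations A" "w' \<in> affine_relations A"
  shows "(\<lambda>a. w a - w' a) \<in> affine_relations A"
proof -
  have "(\<lambda>a. w a + (-1) * w' a) = (\<lambda>a. w a - w' a)" by (rule ext) simp
  then show ?thesis using affine_relations_line[OF assms, of "-1"] by (simp only:)
qed

text \<open>Parameters at which the two factors are nonzero are joined by a complex line inside the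
  parameter space, and the identity theorem applies on it.\<close>

lemma relations_no_zero_divisors:
  assumes "entire_on_lines \<Phi>" "entire_on_lines \<Psi>"
    and zero: "\<And>w x. w \<in> affine_relations A \<Longrightarrow> \<Phi> w x * \<Psi> w x = 0"
  shows "(\<forall>w\<in>affine_relations A. \<forall>x. \<Phi> w x = 0) \<or> (\<forall>w\<in>affine_relations A. \<forall>x. \<Psi> w x = 0)"
proof (rule ccontr)
  assume "\<not> ?thesis"
  then obtain w x w' x' where *: "w \<in> affine_relations A" "\<Phi> w x \<noteq> 0"
    "w' \<in> affine_relations A" "\<Psi> w' x' \<noteq> 0" by blast
  define W where "W s = (\<lambda>a. w a + s * (w' a - w a))" for s
  define X where "X s = (\<lambda>i. x i + s * (x' i - x i))" for s
  have "W s \<in> affine_relations A" for s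
    unfolding W_def by (intro affine_relations_line affine_relations_diff *)
  then have "\<Phi> (W s) (X s) * \<Psi> (W s) (X s) = 0" for s using zero by blast
  moreover have "(\<lambda>s. \<Phi> (W s) (X s)) holomorphic_on UNIV" "(\<lambda>s. \<Psi> (W s) (X s)) holomorphic_on UNIV"
    unfolding W_def X_def
    by (rule assms(1)[unfolded entire_on_lines_def, rule_format]
        assms(2)[unfolded entire_on_lines_def, rule_format])+
  ultimately have "(\<forall>s. \<Phi> (W s) (X s) = 0) \<or> (\<forall>s. \<Psi> (W s) (X s) = 0)"
    using entire_mult_eq_0 by blast
  moreover have "W 0 = w" "X 0 = x" "W 1 = w'" "X 1 = x'" by (simp_all add: W_def X_def)
  ultimately show False using * by metis
qed

lemma entire_on_lines_polyfun:
  fixes A :: "(int ^ 'k::finite) set"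
  assumes "f \<in> polyfun A"
  shows "entire_on_lines (\<lambda>w x. f (torus_act w x))"
  unfolding entire_on_lines_def
proof (intro allI)
  fix w w' :: "int ^ 'k \<Rightarrow> complex" and x x' :: "'k \<Rightarrow> complex"
  have "(\<lambda>s. torus_act (\<lambda>a. w a + s * w' a) (\<lambda>i. x i + s * x' i) a) holomorphic_on UNIV" for a
    unfolding torus_act_def pair_def by (intro holomorphic_intros)
  then show "(\<lambda>s. f (torus_act (\<lambda>a. w a + s * w' a) (\<lambda>i. x i + s * x' i))) holomorphic_on UNIV"
    by (rule polyfun_holomorphic[OF assms])
qed

lemma entire_on_lines_hessian: "entire_on_lines (\<lambda>w x. det (hessian A w))"
  unfolding entire_on_lines_def hessian_def det_def vec_lambda_beta
  by (intro allI) (intro holomorphic_intros)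

lemma entire_on_lines_pair: "entire_on_lines (\<lambda>w x. \<Sum>a\<in>A. w0 a * exp (- pair a x))"
  unfolding entire_on_lines_def pair_def by (intro allI) (intro holomorphic_intros)

lemma det_nonzero_kernel:
  fixes M :: "complex ^ 'k ^ 'k"
  assumes "det M \<noteq> 0" "M *v b = 0" shows "b = 0"
  using assms invertible_det_nz invertible_left_inverse matrix_left_invertible_ker by blast

lemma det_zero_kernel:
  fixes M :: "complex ^ 'k ^ 'k"
  assumes "det M = 0" obtains b where "M *v b = 0" "b \<noteq> 0"
  using assms invertible_det_nz invertible_left_inverse matrix_left_invertible_ker by metis

lemma hessian_mult: "(hessian A w *v b) $ i = (\<Sum>a\<in>A. w a * of_int (a $ i) * pair a (\<lambda>j. b $ j))"
proof -
  have "(hessian A w *v b) $ i = (\<Sum>j\<in>UNIV. \<Sum>a\<in>A. w a * of_int (a $ i) * (of_int (a $ j) * b $ j))"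
    by (simp add: matrix_vector_mult_def hessian_def sum_distrib_right mult.assoc)
  also have "\<dots> = (\<Sum>a\<in>A. w a * of_int (a $ i) * pair a (\<lambda>j. b $ j))"
    unfolding pair_def sum_distrib_left by (rule sum.swap)
  finally show ?thesis .
qed

lemma inj_real_point: "inj real_point"
  by (auto simp: inj_def real_point_def vec_eq_iff)

lemma real_point_nth [simp]: "real_point a $ i = of_int (a $ i)"
  by (simp add: real_point_def)

lemma inner_real_point: "v \<bullet> real_point a = (\<Sum>i\<in>UNIV. v $ i * of_int (a $ i))"
  by (simp add: inner_vec_def)

lemma entire_on_lines_mult:
  "entire_on_lines \<Phi> \<Longrightarrow> entire_on_lines \<Psi> \<Longrightarrow> entire_on_lines (\<lambda>w x. \<Phi> w x * \<Psi> w x)"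
  unfolding entire_on_lines_def by (intro allI holomorphic_on_mult) simp_all

lemma pair_line: "pair a (\<lambda>i. x i + s * e i) = pair a x + s * pair a e"
  by (simp add: pair_def sum_distrib_left sum.distrib algebra_simps)

lemma torus_act_in_singular: "w \<in> affine_relations A \<Longrightarrow> torus_act w x \<in> singular_points A"
  by (auto simp: singular_points_def)

locale not_in_two_hyperplanes =
  fixes A :: "(int ^ 'k::finite) set"
  assumes fin: "finite A"
    and two: "\<not> (\<exists>H1 H2. affine_hyperplane H1 \<and> affine_hyperplane H2 \<and>
            affine_parallel H1 H2 \<and> real_point ` A \<subseteq> H1 \<union> H2)"
begin

text \<open>Hyperplanes with a common normal are translates of each other. The case
  \<open>b1 = b2\<close> is included, so \<open>A\<close> lies in no single hyperplane
  either.\<close>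

lemma not_subset_two: "v \<noteq> 0 \<Longrightarrow> \<not> real_point ` A \<subseteq> {x. v \<bullet> x = b1} \<union> {x. v \<bullet> x = b2}"
proof
  assume v: "v \<noteq> 0" and sub: "real_point ` A \<subseteq> {x. v \<bullet> x = b1} \<union> {x. v \<bullet> x = b2}"
  define u where "u = ((b2 - b1) / (v \<bullet> v)) *\<^sub>R v"
  have u: "v \<bullet> u = b2 - b1" using v by (simp add: u_def)
  have "{x. v \<bullet> x = b2} = (\<lambda>x. u + x) ` {x. v \<bullet> x = b1}"
  proof (intro set_eqI iffI)
    fix x assume "x \<in> {x. v \<bullet> x = b2}"
    then show "x \<in> (\<lambda>x. u + x) ` {x. v \<bullet> x = b1}"
      using u by (intro image_eqI[of _ _ "x - u"]) (auto simp: inner_diff_right)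
  qed (auto simp: inner_add_right u)
  then have "affine_parallel {x. v \<bullet> x = b1} {x. v \<bullet> x = b2}"
    unfolding affine_parallel_def by blast
  moreover have "affine_hyperplane {x. v \<bullet> x = b}" for b using v by (auto simp: affine_hyperplane_def)
  ultimately show False using two sub by blast
qed

lemma not_subset_hyperplane: "v \<noteq> 0 \<Longrightarrow> \<exists>a\<in>A. v \<bullet> real_point a \<noteq> b"
  using not_subset_two[of v b b] by auto

lemma nonempty: "A \<noteq> {}"
  using not_subset_hyperplane[of 1 0] by (auto simp: vec_eq_iff)

text \<open>The Hessian of a real relation is real, so the real and imaginary parts of a complex
  kernel vector lie in the real kernel, which is zero.\<close>

lemma ex_nondegenerate: "\<exists>c\<in>affine_relations A. det (hessian A c) \<noteq> 0"
proof -
  obtain c where c: "(\<Sum>b\<in>real_point ` A. c b) = 0" "(\<Sum>b\<in>real_point ` A. c b *\<^sub>R b) = 0"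
    "\<And>v. (\<And>w. quad (real_point ` A) c v w = 0) \<Longrightarrow> v = 0"
    using ex_affine_relation_nondegenerate[of UNIV "real_point ` A"] not_subset_two fin by auto
  have inj: "inj_on real_point A" using inj_real_point by (rule inj_on_subset) simp
  define d where "d a = c (real_point a)" for a
  have d1: "(\<Sum>a\<in>A. d a) = 0" using c(1) by (simp add: sum.reindex[OF inj] d_def o_def)
  have d2: "(\<Sum>a\<in>A. d a * of_int (a $ i)) = 0" for i
  proof -
    have "(\<Sum>a\<in>A. d a *\<^sub>R real_point a) = 0"
      using c(2) by (simp add: sum.reindex[OF inj] d_def o_def)
    from arg_cong[OF this, of "\<lambda>x. x $ i"] show ?thesis by simp
  qed
  define e where "e a = complex_of_real (d a)" for a
  have "(\<Sum>a\<in>A. e a) = of_real (\<Sum>a\<in>A. d a)" by (simp add: e_def)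
  moreover have "(\<Sum>a\<in>A. e a * of_int (a $ i)) = of_real (\<Sum>a\<in>A. d a * of_int (a $ i))" for i
    by (simp add: e_def)
  ultimately have "e \<in> affine_relations A" by (simp add: affine_relations_def d1 d2)
  moreover have "det (hessian A e) \<noteq> 0"
  proof
    assume "det (hessian A e) = 0"
    then obtain b where b: "hessian A e *v b = 0" "b \<noteq> 0" by (rule det_zero_kernel)
    have key: "v = 0" if v: "\<And>i. (\<Sum>a\<in>A. d a * of_int (a $ i) * (v \<bullet> real_point a)) = 0" for v
    proof (rule c(3))
      fix w
      have "quad (real_point ` A) c v w =
          (\<Sum>a\<in>A. \<Sum>i\<in>UNIV. w $ i * (d a * of_int (a $ i) * (v \<bullet> real_point a)))"
        by (simp add: quad_def sum.reindex[OF inj] d_def o_def inner_real_point[of w]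
            sum_distrib_left mult_ac)
      also have "\<dots> = (\<Sum>i\<in>UNIV. w $ i * (\<Sum>a\<in>A. d a * of_int (a $ i) * (v \<bullet> real_point a)))"
        unfolding sum_distrib_left by (rule sum.swap)
      finally show "quad (real_point ` A) c v w = 0" by (simp add: v)
    qed
    have h: "(\<Sum>a\<in>A. e a * of_int (a $ i) * pair a (\<lambda>j. b $ j)) = 0" for i
      using b(1) by (simp flip: hessian_mult)
    have "Re (pair a (\<lambda>j. b $ j)) = (\<chi> j. Re (b $ j)) \<bullet> real_point a"
      "Im (pair a (\<lambda>j. b $ j)) = (\<chi> j. Im (b $ j)) \<bullet> real_point a" for a
      by (simp_all add: pair_def inner_real_point mult.commute)
    moreover have "Re (e a * of_int n * z) = d a * of_int n * Re z"
      "Im (e a * of_int n * z) = d a * of_int n * Im z" for a n z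
      by (simp_all add: e_def)
    ultimately have re_im: "Re (e a * of_int n * pair a (\<lambda>j. b $ j)) = d a * of_int n * ((\<chi> j. Re (b $ j)) \<bullet> real_point a)"
      "Im (e a * of_int n * pair a (\<lambda>j. b $ j)) = d a * of_int n * ((\<chi> j. Im (b $ j)) \<bullet> real_point a)" for a n
      by (simp_all only:)
    have "(\<Sum>a\<in>A. d a * of_int (a $ i) * ((\<chi> j. Re (b $ j)) \<bullet> real_point a)) = 0"
      "(\<Sum>a\<in>A. d a * of_int (a $ i) * ((\<chi> j. Im (b $ j)) \<bullet> real_point a)) = 0" for i
    proof -
      have "Re (\<Sum>a\<in>A. e a * of_int (a $ i) * pair a (\<lambda>j. b $ j)) = 0"
        "Im (\<Sum>a\<in>A. e a * of_int (a $ i) * pair a (\<lambda>j. b $ j)) = 0" by (simp_all only: h zero_complex.sel)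
      then show "(\<Sum>a\<in>A. d a * of_int (a $ i) * ((\<chi> j. Re (b $ j)) \<bullet> real_point a)) = 0"
        "(\<Sum>a\<in>A. d a * of_int (a $ i) * ((\<chi> j. Im (b $ j)) \<bullet> real_point a)) = 0"
        by (simp_all only: Re_sum Im_sum re_im)
    qed
    then have "(\<chi> j. Re (b $ j)) = 0" "(\<chi> j. Im (b $ j)) = 0" using key by blast+
    then have "b = 0" by (simp add: vec_eq_iff complex_eq_iff)
    then show False using b(2) by blast
  qed
  ultimately show ?thesis by blast
qed

text \<open>Least squares fit of an affine function; the residual is an affine relation.\<close>

lemma ex_affine_fit:
  fixes y :: "int ^ 'k \<Rightarrow> real"
  obtains \<alpha> v where "(\<Sum>a\<in>A. y a - (\<alpha> + v \<bullet> real_point a)) = 0"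
    "(\<Sum>a\<in>A. (y a - (\<alpha> + v \<bullet> real_point a)) *\<^sub>R real_point a) = 0"
proof -
  \<comment> \<open>The operator of the normal equations. The inner product of \<open>p\<close> and
    \<open>S p\<close> is the sum over \<open>A\<close> of the squares of the affine function
    \<open>p\<close>, so \<open>S\<close> is injective because no hyperplane contains
    \<open>A\<close>.\<close>
  define S :: "real \<times> (real ^ 'k) \<Rightarrow> real \<times> (real ^ 'k)" where
    "S p = (\<Sum>a\<in>A. fst p + snd p \<bullet> real_point a, \<Sum>a\<in>A. (fst p + snd p \<bullet> real_point a) *\<^sub>R real_point a)" for p
  have lin: "linear S"
    by (rule linearI)
      (auto simp: S_def algebra_simps sum.distrib sum_distrib_left scaleR_sum_right inner_add_left)
  have "p = 0" if "S p = 0" for p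
  proof -
    have "(\<Sum>a\<in>A. (fst p + snd p \<bullet> real_point a)\<^sup>2) = p \<bullet> S p"
      by (simp add: S_def inner_prod_def inner_sum_right sum_distrib_left power2_eq_square
          algebra_simps sum.distrib)
    then have "\<forall>a\<in>A. (fst p + snd p \<bullet> real_point a)\<^sup>2 = 0"
      using that fin by (subst sum_nonneg_eq_0_iff[symmetric]) auto
    then have z: "snd p \<bullet> real_point a = - fst p" if "a \<in> A" for a
    proof -
      have "fst p + snd p \<bullet> real_point a = 0" using \<open>\<forall>a\<in>A. _ = 0\<close> that by simp
      then show ?thesis by linarith
    qed
    then have "snd p = 0" using not_subset_hyperplane[of "snd p" "- fst p"] by blast
    moreover have "fst p = 0" using z nonempty calculation by force
    ultimately show ?thesis by (simp add: prod_eq_iff)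
  qed
  then have "inj S" using linear_injective_0[OF lin] by blast
  then have "surj S" using lin linear_injective_imp_surjective by blast
  then obtain p where p: "S p = (\<Sum>a\<in>A. y a, \<Sum>a\<in>A. y a *\<^sub>R real_point a)" by (metis surj_def)
  show ?thesis
    by (rule that[of "fst p" "snd p"])
      (use p in \<open>simp_all add: S_def sum_subtractf scaleR_left_diff_distrib\<close>)
qed

text \<open>The residual of the fit is a relation, hence orthogonal to \<open>y\<close> and to all
  affine functions, and so to itself.\<close>

lemma affine_if_orthogonal_to_relations_real:
  fixes y :: "int ^ 'k \<Rightarrow> real"
  assumes "\<And>w :: int ^ 'k \<Rightarrow> real. (\<Sum>a\<in>A. w a) = 0 \<Longrightarrow> (\<And>i. (\<Sum>a\<in>A. w a * of_int (a $ i)) = 0) \<Longrightarrow>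
    (\<Sum>a\<in>A. y a * w a) = 0"
  obtains \<alpha> v where "\<And>a. a \<in> A \<Longrightarrow> y a = \<alpha> + v \<bullet> real_point a"
proof -
  obtain \<alpha> v where r1: "(\<Sum>a\<in>A. y a - (\<alpha> + v \<bullet> real_point a)) = 0"
    and r2: "(\<Sum>a\<in>A. (y a - (\<alpha> + v \<bullet> real_point a)) *\<^sub>R real_point a) = 0"
    by (rule ex_affine_fit)
  define r where "r a = y a - (\<alpha> + v \<bullet> real_point a)" for a
  have r1: "(\<Sum>a\<in>A. r a) = 0" and r2: "(\<Sum>a\<in>A. r a *\<^sub>R real_point a) = 0"
    using r1 r2 by (simp_all add: r_def)
  have "(\<Sum>a\<in>A. r a * of_int (a $ i)) = 0" for i
    using arg_cong[OF r2, of "\<lambda>x. x $ i"] by simp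
  then have "(\<Sum>a\<in>A. y a * r a) = 0" using assms r1 by blast
  moreover have "(\<Sum>a\<in>A. (r a)\<^sup>2) =
      (\<Sum>a\<in>A. y a * r a) - \<alpha> * (\<Sum>a\<in>A. r a) - v \<bullet> (\<Sum>a\<in>A. r a *\<^sub>R real_point a)"
    unfolding sum_distrib_left inner_sum_right sum_subtractf[symmetric]
    by (intro sum.cong refl) (simp add: r_def power2_eq_square algebra_simps)
  ultimately have "(\<Sum>a\<in>A. (r a)\<^sup>2) = 0" by (simp add: r1 r2)
  then have "r a = 0" if "a \<in> A" for a using fin that by (simp add: sum_nonneg_eq_0_iff)
  then show ?thesis using that[of \<alpha> v] by (simp add: r_def)
qed

lemma affine_if_orthogonal_to_relations:
  assumes y: "\<And>w. w \<in> affine_relations A \<Longrightarrow> (\<Sum>a\<in>A. y a * w a) = 0"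
  obtains \<alpha> \<beta> where "\<And>a. a \<in> A \<Longrightarrow> y a = \<alpha> + pair a \<beta>"
proof -
  have rel: "(\<Sum>a\<in>A. y a * of_real (w a)) = 0"
    if "(\<Sum>a\<in>A. w a) = 0" "\<And>i. (\<Sum>a\<in>A. w a * of_int (a $ i)) = 0" for w :: "int ^ 'k \<Rightarrow> real"
  proof (rule y)
    have "(\<Sum>a\<in>A. complex_of_real (w a)) = of_real (\<Sum>a\<in>A. w a)"
      by (rule of_real_sum[symmetric])
    moreover have "(\<Sum>a\<in>A. complex_of_real (w a) * of_int (a $ i)) = of_real (\<Sum>a\<in>A. w a * of_int (a $ i))" for i
      by (simp only: of_real_sum of_real_mult of_real_of_int_eq)
    ultimately show "(\<lambda>a. complex_of_real (w a)) \<in> affine_relations A"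
      using that by (simp only: affine_relations_def mem_Collect_eq of_real_0) simp
  qed
  have re: "(\<Sum>a\<in>A. Re (y a) * w a) = 0" and im: "(\<Sum>a\<in>A. Im (y a) * w a) = 0"
    if "(\<Sum>a\<in>A. w a) = 0" "\<And>i. (\<Sum>a\<in>A. w a * of_int (a $ i)) = 0" for w :: "int ^ 'k \<Rightarrow> real"
    using arg_cong[OF rel[OF that], of Re] arg_cong[OF rel[OF that], of Im] by simp_all
  obtain \<alpha> v where v: "\<And>a. a \<in> A \<Longrightarrow> Re (y a) = \<alpha> + v \<bullet> real_point a"
    using affine_if_orthogonal_to_relations_real[OF re] by blast
  obtain \<alpha>' v' where v': "\<And>a. a \<in> A \<Longrightarrow> Im (y a) = \<alpha>' + v' \<bullet> real_point a"
    using affine_if_orthogonal_to_relations_real[OF im] by blast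
  show ?thesis
    by (rule that[of "Complex \<alpha> \<alpha>'" "\<lambda>i. Complex (v $ i) (v' $ i)"])
      (simp add: complex_eq_iff v v' pair_def inner_real_point mult.commute)
qed

text \<open>An affine basis \<open>D\<close> taken from \<open>A\<close> has
  \<open>CARD('k) + 1\<close> points, and the values of a relation outside \<open>D\<close>
  determine those on \<open>D\<close>. Together with the torus coordinates this leaves
  \<open>card A - 1\<close> parameters, so an equation for the singular points can exist.\<close>

lemma relation_coordinates:
  obtains F L where "F \<subseteq> A" "card F + CARD('k) < card A"
    "\<And>w a. w \<in> affine_relations A \<Longrightarrow> a \<in> A \<Longrightarrow> w a = (\<Sum>f\<in>F. L a f * w f)"
proof -
  obtain B where B: "B \<subseteq> real_point ` A" "\<not> affine_dependent B" "affine hull (real_point ` A) = affine hull B"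
    using affine_basis_exists by blast
  define D where "D = {a \<in> A. real_point a \<in> B}"
  have D: "D \<subseteq> A" "finite D" "real_point ` D = B" using B fin by (auto simp: D_def)
  have injD: "inj_on real_point D" using inj_real_point by (rule inj_on_subset) simp
  have finB: "finite B" using D by blast
  have "aff_dim (real_point ` A) = DIM(real ^ 'k)"
  proof (rule ccontr)
    assume "aff_dim (real_point ` A) \<noteq> DIM(real ^ 'k)"
    then have "aff_dim (real_point ` A) < DIM(real ^ 'k)"
      using aff_dim_le_DIM[of "real_point ` A"] by linarith
    then obtain v b where "v \<noteq> 0" "real_point ` A \<subseteq> {x. v \<bullet> x = b}"
      by (rule aff_lowdim_subset_hyperplane)
    then show False using not_subset_hyperplane[of v b] by auto
  qed
  moreover have "int (card B) = aff_dim (real_point ` A) + 1"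
    using B aff_dim_affine_independent[OF B(2)] aff_dim_affine_hull by metis
  ultimately have "card B = CARD('k) + 1" and hull: "affine hull B = UNIV"
    using B(3) aff_dim_eq_full[of "real_point ` A"] by auto
  then have cardD: "card D = CARD('k) + 1" using D(3) card_image[OF injD] by simp
  have "\<exists>s. sum s D = 1 \<and> (\<Sum>b\<in>D. s b *\<^sub>R real_point b) = x" for x
  proof -
    have "x \<in> affine hull B" using hull by simp
    then obtain u where "sum u B = 1" "(\<Sum>v\<in>B. u v *\<^sub>R v) = x"
      unfolding affine_hull_finite[OF finB] by blast
    then show ?thesis unfolding D(3)[symmetric] sum.reindex[OF injD] o_def by blast
  qed
  then obtain s where s: "\<And>x. sum (s x) D = 1" "\<And>x. (\<Sum>b\<in>D. s x b *\<^sub>R real_point b) = x" by metis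
  have s_i: "(\<Sum>b\<in>D. s (real_point a) b * of_int (b $ i)) = of_int (a $ i)" for a i
    using arg_cong[OF s(2)[of "real_point a"], of "\<lambda>x. x $ i"] by simp
  have indep: "u b = 0" if u: "sum u D = 0" "\<And>i. (\<Sum>b\<in>D. u b * of_int (b $ i)) = 0" and b: "b \<in> D"
    for u :: "int ^ 'k \<Rightarrow> real" and b
  proof (rule ccontr)
    assume "u b \<noteq> 0"
    define U where "U = u \<circ> the_inv_into D real_point"
    have U: "U (real_point b) = u b" if "b \<in> D" for b using that by (simp add: U_def the_inv_into_f_f[OF injD])
    have "sum U B = 0" unfolding D(3)[symmetric] sum.reindex[OF injD] using u(1) by (simp add: U o_def)
    moreover have "(\<Sum>v\<in>B. U v *\<^sub>R v) = 0"
      unfolding D(3)[symmetric] sum.reindex[OF injD]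
      using u(2) by (simp add: U o_def vec_eq_iff)
    moreover have "\<exists>v\<in>B. U v \<noteq> 0"
      using b \<open>u b \<noteq> 0\<close> U[OF b] D(3) by (intro bexI[of _ "real_point b"]) auto
    ultimately show False using B(2) affine_dependent_explicit_finite[OF finB] by blast
  qed
  have indepC: "u b = 0" if u: "sum u D = 0" "\<And>i. (\<Sum>b\<in>D. u b * of_int (b $ i)) = 0" and b: "b \<in> D"
    for u :: "int ^ 'k \<Rightarrow> complex" and b
  proof -
    have "Re (u b) = 0"
    proof (rule indep[of "\<lambda>b. Re (u b)", OF _ _ b])
      show "(\<Sum>b\<in>D. Re (u b)) = 0" using arg_cong[OF u(1), of Re] by simp
      show "(\<Sum>b\<in>D. Re (u b) * of_int (b $ i)) = 0" for i
        using arg_cong[OF u(2)[of i], of Re] by simp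
    qed
    moreover have "Im (u b) = 0"
    proof (rule indep[of "\<lambda>b. Im (u b)", OF _ _ b])
      show "(\<Sum>b\<in>D. Im (u b)) = 0" using arg_cong[OF u(1), of Im] by simp
      show "(\<Sum>b\<in>D. Im (u b) * of_int (b $ i)) = 0" for i
        using arg_cong[OF u(2)[of i], of Im] by simp
    qed
    ultimately show ?thesis by (simp add: complex_eq_iff)
  qed
  define F where "F = A - D"
  define L where "L a f = (if a \<in> F then (if f = a then 1 else 0) else - complex_of_real (s (real_point f) a))" for a f
  show ?thesis
  proof
    show "F \<subseteq> A" by (auto simp: F_def)
    show "card F + CARD('k) < card A"
      using card_Diff_subset[OF D(2,1)] card_mono[OF fin D(1)] cardD by (simp add: F_def)
    fix w a assume w: "w \<in> affine_relations A" and a: "a \<in> A"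
    have finF: "finite F" using fin by (simp add: F_def)
    have split: "(\<Sum>a\<in>A. g a) = (\<Sum>b\<in>D. g b) + (\<Sum>f\<in>F. g f)" for g :: "int ^ 'k \<Rightarrow> complex"
      unfolding F_def using sum.subset_diff[OF D(1) fin, of g] by (simp add: add.commute)
    show "w a = (\<Sum>f\<in>F. L a f * w f)"
    proof (cases "a \<in> F")
      case True
      then show ?thesis using finF by (simp add: L_def if_distrib[of "\<lambda>x. x * _"] cong: if_cong)
    next
      case False
      \<comment> \<open>Each \<open>f\<close> in \<open>F\<close> is an affine combination of
        \<open>D\<close>, and its weight is moved there. The result is a relation on the independent
        set \<open>D\<close>, hence zero.\<close>
      define u where "u b = w b + (\<Sum>f\<in>F. w f * of_real (s (real_point f) b))" for b
      have sum_u: "(\<Sum>b\<in>D. u b * t b) = (\<Sum>b\<in>D. w b * t b) + (\<Sum>f\<in>F. w f * (\<Sum>b\<in>D. of_real (s (real_point f) b) * t b))" for t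
        by (simp add: u_def distrib_right sum.distrib sum_distrib_left sum_distrib_right mult.assoc sum.swap[of _ D F])
      have "(\<Sum>b\<in>D. of_real (s (real_point f) b) * (1::complex)) = 1" for f
        using arg_cong[OF s(1)[of "real_point f"], of complex_of_real] by simp
      then have "sum u D = (\<Sum>a\<in>A. w a)" using sum_u[of "\<lambda>_. 1"] split[of w] by simp
      moreover have "(\<Sum>b\<in>D. of_real (s (real_point f) b) * (of_int (b $ i) :: complex)) = of_int (f $ i)" for f i
        using arg_cong[OF s_i[of f i], of complex_of_real] by simp
      then have "(\<Sum>b\<in>D. u b * of_int (b $ i)) = (\<Sum>a\<in>A. w a * of_int (a $ i))" for i
        using sum_u[of "\<lambda>b. of_int (b $ i)"] split[of "\<lambda>a. w a * of_int (a $ i)"] by simp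
      ultimately have "u a = 0" using indepC[of u a] w a False by (simp add: affine_relations_def F_def)
      then show ?thesis using False by (simp add: u_def L_def sum_negf add_eq_0_iff2 mult.commute)
    qed
  qed
qed

definition discriminant_ideal :: "((int ^ 'k \<Rightarrow> complex) \<Rightarrow> complex) set" where
  "discriminant_ideal = {f \<in> polyfun A. \<forall>z\<in>singular_points A. f z = 0}"

text \<open>At a singular point with nondegenerate Hessian and singularity at \<open>y\<close>, the gradient of a
  function vanishing on all singular points is proportional to \<open>(y\<^sup>a)\<^sub>a\<close>, so it vanishes if
  it is orthogonal to a polynomial \<open>w0\<close> with \<open>w0(y) \<noteq> 0\<close>.\<close>

lemma gradient_vanishes_generically:
  assumes g: "\<And>z. z \<in> singular_points A \<Longrightarrow> g z = 0"
    and inv: "\<And>c t. g (\<lambda>a. c a + t * w0 a) = g c"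
    and grad: "\<And>\<gamma> \<gamma>' s. (\<And>a. a \<in> A \<Longrightarrow> ((\<lambda>s. \<gamma> s a) has_field_derivative \<gamma>' a) (at s)) \<Longrightarrow>
       ((\<lambda>s. g (\<gamma> s)) has_field_derivative (\<Sum>a\<in>A. G a (\<gamma> s) * \<gamma>' a)) (at s)"
    and w: "w \<in> affine_relations A" and det: "det (hessian A w) \<noteq> 0"
    and w0: "(\<Sum>a\<in>A. w0 a * exp (- pair a x)) \<noteq> 0" and a: "a \<in> A"
  shows "G a (torus_act w x) = 0"
proof -
  define z where "z = torus_act w x"
  \<comment> \<open>The gradient rescaled by the torus action, so that tangent directions can be
    read off at (1, ..., 1).\<close>
  define y where "y a = G a z * exp (pair a x)" for a
  have const: "(\<Sum>a\<in>A. G a (\<gamma> 0) * \<gamma>' a) = 0"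
    if "\<And>s. g (\<gamma> s) = g (\<gamma> 0)" "\<And>a. a \<in> A \<Longrightarrow> ((\<lambda>s. \<gamma> s a) has_field_derivative \<gamma>' a) (at 0)" for \<gamma> \<gamma>'
  proof (rule DERIV_unique)
    show "((\<lambda>s. g (\<gamma> s)) has_field_derivative (\<Sum>a\<in>A. G a (\<gamma> 0) * \<gamma>' a)) (at 0)"
      using that(2) by (rule grad)
    have "(\<lambda>s. g (\<gamma> s)) = (\<lambda>_. g (\<gamma> 0))" using that(1) by blast
    then show "((\<lambda>s. g (\<gamma> s)) has_field_derivative 0) (at 0)" by simp
  qed
  \<comment> \<open>Vary the relation: the rescaled gradient is orthogonal to all relations, hence
    affine in \<open>a\<close>.\<close>
  have "(\<Sum>a\<in>A. y a * w' a) = 0" if w': "w' \<in> affine_relations A" for w'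
  proof -
    define \<gamma> where "\<gamma> s = torus_act (\<lambda>a. w a + s * w' a) x" for s
    have "g (\<gamma> s) = 0" for s
      unfolding \<gamma>_def by (intro g torus_act_in_singular affine_relations_line w w')
    moreover have "((\<lambda>s. \<gamma> s a) has_field_derivative (w' a * exp (pair a x))) (at 0)" for a
      unfolding \<gamma>_def torus_act_def by (auto intro!: derivative_eq_intros)
    ultimately have "(\<Sum>a\<in>A. G a (\<gamma> 0) * (w' a * exp (pair a x))) = 0"
      by (intro const) simp_all
    moreover have "\<gamma> 0 = z" by (simp add: \<gamma>_def z_def)
    ultimately show ?thesis by (simp add: y_def mult_ac)
  qed
  then obtain \<alpha> \<beta> where y: "\<And>a. a \<in> A \<Longrightarrow> y a = \<alpha> + pair a \<beta>"
    using affine_if_orthogonal_to_relations[of y] by blast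
  \<comment> \<open>Vary the coordinate \<open>x j\<close>: the constant \<open>\<alpha>\<close>
    drops out because \<open>w\<close> is a relation, and \<open>\<beta>\<close> falls into the
    kernel of the Hessian.\<close>
  have "(\<Sum>a\<in>A. w a * of_int (a $ j) * pair a \<beta>) = 0" for j
  proof -
    define e where "e i = (if i = j then 1 else 0 :: complex)" for i
    have e: "pair a e = of_int (a $ j)" for a
      by (simp add: pair_def e_def if_distrib[of "\<lambda>x. _ * x"] cong: if_cong)
    define \<gamma> where "\<gamma> s = torus_act w (\<lambda>i. x i + s * e i)" for s
    have "g (\<gamma> s) = 0" for s unfolding \<gamma>_def by (intro g torus_act_in_singular w)
    moreover have "((\<lambda>s. \<gamma> s a) has_field_derivative (w a * exp (pair a x) * of_int (a $ j))) (at 0)" for a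
      unfolding \<gamma>_def torus_act_def pair_line e by (auto intro!: derivative_eq_intros)
    ultimately have "(\<Sum>a\<in>A. G a (\<gamma> 0) * (w a * exp (pair a x) * of_int (a $ j))) = 0"
      by (intro const) simp_all
    moreover have "\<gamma> 0 = z" by (simp add: \<gamma>_def z_def)
    ultimately have "0 = (\<Sum>a\<in>A. y a * (w a * of_int (a $ j)))" by (simp add: y_def mult_ac)
    also have "\<dots> = (\<Sum>a\<in>A. \<alpha> * (w a * of_int (a $ j)) + w a * of_int (a $ j) * pair a \<beta>)"
      by (intro sum.cong refl) (simp add: y algebra_simps)
    also have "\<dots> = \<alpha> * (\<Sum>a\<in>A. w a * of_int (a $ j)) + (\<Sum>a\<in>A. w a * of_int (a $ j) * pair a \<beta>)"
      by (simp add: sum.distrib sum_distrib_left)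
    finally show ?thesis using w by (simp add: affine_relations_def)
  qed
  then have "hessian A w *v (\<chi> i. \<beta> i) = 0" by (simp add: vec_eq_iff hessian_mult)
  then have "(\<chi> i. \<beta> i) = 0" using det det_nonzero_kernel by blast
  then have "\<beta> i = 0" for i by (simp add: vec_eq_iff)
  then have G: "G a z = \<alpha> * exp (- pair a x)" if "a \<in> A" for a
    using y[OF that] by (simp add: y_def pair_def exp_minus field_simps)
  \<comment> \<open>Invariance makes the gradient orthogonal to \<open>w0\<close>, which forces
    \<open>\<alpha> = 0\<close>.\<close>
  have "(\<Sum>a\<in>A. G a (\<lambda>a. z a + 0 * w0 a) * w0 a) = 0"
    by (rule const[of "\<lambda>s a. z a + s * w0 a"]) (auto simp: inv intro!: derivative_eq_intros)
  then have "\<alpha> * (\<Sum>a\<in>A. w0 a * exp (- pair a x)) = 0"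
    by (simp add: G sum_distrib_left mult_ac)
  then show ?thesis using w0 G[OF a] by (simp add: z_def)
qed

text \<open>Partial derivatives of an invariant element of the ideal are invariant and vanish at
  generic singular points, so at all of them by the identity theorem. The invariant elements are
  therefore closed under differentiation, and they vanish at the origin, which is a singular
  point.\<close>

lemma no_invariant_in_ideal:
  assumes w0: "(\<Sum>a\<in>A. w0 a) \<noteq> 0"
    and g: "g \<in> discriminant_ideal" "\<And>c t. g (\<lambda>a. c a + t * w0 a) = g c"
  shows "g = 0"
proof -
  define J where "J = {g \<in> discriminant_ideal. \<forall>c t. g (\<lambda>a. c a + t * w0 a) = g c}"
  have "(\<lambda>_. 0) \<in> affine_relations A" by (simp add: affine_relations_def)
  from torus_act_in_singular[OF this] have zero: "(\<lambda>_. 0) \<in> singular_points A" by (simp add: torus_act_def)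
  obtain c where c: "c \<in> affine_relations A" "det (hessian A c) \<noteq> 0" using ex_nondegenerate by blast
  show ?thesis
  proof (rule polyfun_zero_if_gradient_closed[OF fin, of J "\<lambda>_. 0"])
    show "J \<subseteq> polyfun A" by (auto simp: J_def discriminant_ideal_def)
    show "h (\<lambda>_. 0) = 0" if "h \<in> J" for h using that zero by (auto simp: J_def discriminant_ideal_def)
    show "0 \<in> J" by (auto simp: J_def discriminant_ideal_def polyfun_zero)
    show "f + h \<in> J" if "f \<in> J" "h \<in> J" for f h
      using that by (auto simp: J_def discriminant_ideal_def intro: polyfun_plus)
    show "(\<lambda>c. k * f c) \<in> J" if "f \<in> J" for k f
      using that by (auto simp: J_def discriminant_ideal_def intro!: polyfun_mult polyfun_const)
    show "g \<in> J" using g by (auto simp: J_def)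
    fix h assume h: "h \<in> J"
    then have hA: "h \<in> polyfun A" and h0: "\<And>z. z \<in> singular_points A \<Longrightarrow> h z = 0"
      and inv: "\<And>c t. h (\<lambda>a. c a + t * w0 a) = h c" by (auto simp: J_def discriminant_ideal_def)
    obtain G where G: "\<And>a. a \<in> A \<Longrightarrow> G a \<in> polyfun A"
      "\<And>\<gamma> \<gamma>' s. (\<And>a. a \<in> A \<Longrightarrow> ((\<lambda>s. \<gamma> s a) has_field_derivative \<gamma>' a) (at s)) \<Longrightarrow>
       ((\<lambda>s. h (\<gamma> s)) has_field_derivative (\<Sum>a\<in>A. G a (\<gamma> s) * \<gamma>' a)) (at s)"
      using polyfun_gradient[OF fin hA] by blast
    have "G a z = 0" if a: "a \<in> A" and z: "z \<in> singular_points A" for a z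
    proof -
      let ?D = "\<lambda>(w :: int ^ 'k \<Rightarrow> complex) (x :: 'k \<Rightarrow> complex). det (hessian A w)"
      let ?E = "\<lambda>(w :: int ^ 'k \<Rightarrow> complex) (x :: 'k \<Rightarrow> complex). \<Sum>a\<in>A. w0 a * exp (- pair a x)"
      have "G a (torus_act w x) * (?D w x * ?E w x) = 0" if "w \<in> affine_relations A" for w x
        using gradient_vanishes_generically[OF h0 inv G(2) that _ _ a, of x] by auto
      then have "(\<forall>w\<in>affine_relations A. \<forall>x. G a (torus_act w x) = 0) \<or>
          (\<forall>w\<in>affine_relations A. \<forall>x. ?D w x * ?E w x = 0)"
        by (intro relations_no_zero_divisors entire_on_lines_polyfun[OF G(1)[OF a]]
            entire_on_lines_mult entire_on_lines_hessian entire_on_lines_pair)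
      \<comment> \<open>At \<open>x = 0\<close> the second factor is the sum of \<open>w0\<close>;
        this is where that sum must be nonzero.\<close>
      moreover have "?D c (\<lambda>_. 0) * ?E c (\<lambda>_. 0) \<noteq> 0" using c w0 by (simp add: pair_def)
      ultimately have "\<forall>w\<in>affine_relations A. \<forall>x. G a (torus_act w x) = 0" using c(1) by blast
      then show ?thesis using z by (auto simp: singular_points_def)
    qed
    moreover have "G a (\<lambda>b. c b + t * w0 b) = G a c" if a: "a \<in> A" for a c t
    proof -
      define e where "e b = (if b = a then 1 else 0 :: complex)" for b
      have D: "((\<lambda>s. h (\<lambda>b. d b + s * e b)) has_field_derivative G a d) (at 0)" for d
      proof -
        have "((\<lambda>s. h (\<lambda>b. d b + s * e b)) has_field_derivative
            (\<Sum>b\<in>A. G b (\<lambda>b. d b + 0 * e b) * e b)) (at 0)"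
          by (rule G(2)) (auto intro!: derivative_eq_intros)
        then show ?thesis using a fin
          by (simp add: e_def if_distrib[of "\<lambda>x. _ * x"] cong: if_cong)
      qed
      have "h (\<lambda>b. (c b + t * w0 b) + s * e b) = h (\<lambda>b. c b + s * e b)" for s
        using inv[of "\<lambda>b. c b + s * e b" t] by (simp add: add_ac)
      then show ?thesis using D[of c] D[of "\<lambda>b. c b + t * w0 b"] DERIV_unique by fastforce
    qed
    ultimately have "G a \<in> J" if "a \<in> A" for a
      using that G(1) by (auto simp: J_def discriminant_ideal_def)
    then show "\<exists>G. (\<forall>a\<in>A. G a \<in> J) \<and>
      (\<forall>\<gamma> \<gamma>' s. (\<forall>a\<in>A. ((\<lambda>s. \<gamma> s a) has_field_derivative \<gamma>' a) (at s)) \<longrightarrow>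
       ((\<lambda>s. h (\<gamma> s)) has_field_derivative (\<Sum>a\<in>A. G a (\<gamma> s) * \<gamma>' a)) (at s))"
      using G(2) by blast
  qed
qed

lemma ex_nonzero_in_ideal: "\<exists>p\<in>discriminant_ideal. p \<noteq> 0"
proof -
  obtain F L where F: "F \<subseteq> A" "card F + CARD('k) < card A"
    "\<And>w a. w \<in> affine_relations A \<Longrightarrow> a \<in> A \<Longrightarrow> w a = (\<Sum>f\<in>F. L a f * w f)"
    using relation_coordinates by blast
  have "finite F" using F(1) fin finite_subset by blast
  then obtain p where p: "p \<in> polyfun A" "p \<noteq> 0"
    "\<And>w x. p (\<lambda>a. (\<Sum>f\<in>F. L a f * w f) * exp (pair a x)) = 0"
    using ex_algebraic_relation[OF fin _ F(2), of "\<lambda>a x. exp (pair a x)" L] by (auto simp: pair_def)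
  have "p (torus_act w x) = 0" if "w \<in> affine_relations A" for w x
    using p(3)[of w x] polyfun_cong[OF p(1), of "torus_act w x"] F(3)[OF that]
    by (simp add: torus_act_def)
  then show ?thesis using p by (auto simp: discriminant_ideal_def singular_points_def)
qed

lemma ideal_principal:
  obtains p where "p \<in> discriminant_ideal" "p \<noteq> 0"
    "\<And>q. q \<in> discriminant_ideal \<Longrightarrow> \<exists>s. q = p * s"
proof -
  obtain p1 where p1: "p1 \<in> polyfun A" "p1 \<noteq> 0" "\<And>z. z \<in> singular_points A \<Longrightarrow> p1 z = 0"
    using ex_nonzero_in_ideal by (auto simp: discriminant_ideal_def)
  \<comment> \<open>Relations can be scaled, so there is a homogeneous equation.\<close>
  have cone: "(\<lambda>a. t * z a) \<in> singular_points A" if z: "z \<in> singular_points A" for z t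
  proof -
    obtain w x where wx: "z = torus_act w x" "w \<in> affine_relations A" using z by (auto simp: singular_points_def)
    have "(\<lambda>a. 0 + t * w a) \<in> affine_relations A"
      using wx(2) by (intro affine_relations_line) (auto simp: affine_relations_def)
    from torus_act_in_singular[OF this, of x] show ?thesis by (simp add: wx torus_act_def mult.assoc)
  qed
  obtain h n where h: "h \<in> polyfun A" "h \<noteq> 0" "\<And>z. z \<in> singular_points A \<Longrightarrow> h z = 0"
    "\<And>t c. h (\<lambda>a. t * c a) = t ^ n * h c"
    using homogeneous_component[OF p1 cone] by blast
  define \<sigma> where "\<sigma> c = (\<Sum>a\<in>A. c a)" for c :: "int ^ 'k \<Rightarrow> complex"
  have "\<sigma> \<in> polyfun A" unfolding \<sigma>_def by (intro polyfun_sum polyfun_var)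
  moreover have "\<sigma> (\<lambda>_. 1) \<noteq> 0" using nonempty fin by (simp add: \<sigma>_def)
  then have "\<sigma> \<noteq> 0" by auto
  ultimately have "h * \<sigma> \<noteq> 0" using polyfun_no_zero_divisors[OF h(1)] h(2) by blast
  \<comment> \<open>One vector serves two purposes: \<open>h w0 \<noteq> 0\<close> gives an element
    monic along \<open>w0\<close>, and the nonzero sum rules out nonzero invariant elements of the
    ideal.\<close>
  then obtain w0 where w0: "h w0 \<noteq> 0" "(\<Sum>a\<in>A. w0 a) \<noteq> 0" by (auto simp: fun_eq_iff \<sigma>_def)
  define p0 where "p0 c = inverse (h w0) * h c" for c
  have p0: "p0 \<in> polyfun A" unfolding p0_def by (intro polyfun_mult polyfun_const h)
  obtain P0 where P0: "P0 \<in> polys_over (polyfun A)" "lead_coeff P0 = 1"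
    "\<And>c t. p0 (\<lambda>a. c a + t * w0 a) = poly P0 (\<lambda>_. t) c"
    using homogeneous_monic[OF p0, of n w0] h(4) w0(1) by (auto simp: p0_def)
  obtain a0 where a0: "a0 \<in> A" "w0 a0 \<noteq> 0" using w0(2) by (metis sum.neutral)
  interpret vanishing_ideal A "singular_points A" w0 a0 p0 P0 discriminant_ideal
  proof (unfold_locales, fact discriminant_ideal_def, fact a0(1), fact a0(2))
    show "g = 0" if "g \<in> discriminant_ideal" "\<And>c t. g (\<lambda>a. c a + t * w0 a) = g c" for g
      by (rule no_invariant_in_ideal[OF w0(2) that])
    show "p0 \<in> discriminant_ideal" using p0 h(3) by (simp add: discriminant_ideal_def p0_def)
    fix f g assume fg: "f \<in> polyfun A" "g \<in> polyfun A" "f * g \<in> discriminant_ideal"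
    then have "f (torus_act w x) * g (torus_act w x) = 0" if "w \<in> affine_relations A" for w x
      using torus_act_in_singular[OF that] by (auto simp: discriminant_ideal_def)
    then have "(\<forall>w\<in>affine_relations A. \<forall>x. f (torus_act w x) = 0) \<or>
        (\<forall>w\<in>affine_relations A. \<forall>x. g (torus_act w x) = 0)"
      by (rule relations_no_zero_divisors[OF entire_on_lines_polyfun[OF fg(1)]
          entire_on_lines_polyfun[OF fg(2)]])
    then show "f \<in> discriminant_ideal \<or> g \<in> discriminant_ideal"
      using fg by (auto simp: discriminant_ideal_def singular_points_def)
  qed (fact P0)+
  show ?thesis using principal that by blast
qed

end

section \<open>Coefficients of singular Laurent polynomials\<close>

lemma mpoly_eval_superset:
  assumes "finite S" "Poly_Mapping.keys p \<subseteq> S"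
  shows "mpoly_eval p c = (\<Sum>m\<in>S. Poly_Mapping.lookup p m *
    (\<Prod>x\<in>Poly_Mapping.keys m. c x ^ Poly_Mapping.lookup m x))"
  unfolding mpoly_eval_def
  by (rule sum.mono_neutral_left) (use assms in \<open>auto simp: in_keys_iff\<close>)

lemma mpoly_eval_add: "mpoly_eval (p + q) c = mpoly_eval p c + mpoly_eval q c"
proof -
  define S where "S = Poly_Mapping.keys p \<union> Poly_Mapping.keys q"
  have "finite S" "Poly_Mapping.keys p \<subseteq> S" "Poly_Mapping.keys q \<subseteq> S" "Poly_Mapping.keys (p + q) \<subseteq> S"
    using keys_add[of p q] by (auto simp: S_def)
  then show ?thesis
    by (simp add: mpoly_eval_superset[of S] lookup_add distrib_right sum.distrib)
qed

lemma mpoly_eval_zero [simp]: "mpoly_eval 0 c = 0"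
  by (simp add: mpoly_eval_def)

lemma mpoly_eval_sum: "mpoly_eval (\<Sum>i\<in>S. p i) c = (\<Sum>i\<in>S. mpoly_eval (p i) c)"
  by (induction S rule: infinite_finite_induct) (auto simp: mpoly_eval_add)

lemma mpoly_eval_single:
  "mpoly_eval (Poly_Mapping.single m k) c =
     k * (\<Prod>x\<in>Poly_Mapping.keys m. c x ^ Poly_Mapping.lookup m x)"
  by (cases "k = 0") (simp_all add: mpoly_eval_def)

lemma monomial_eval_add:
  fixes m n :: "'x \<Rightarrow>\<^sub>0 nat"
  shows "(\<Prod>x\<in>Poly_Mapping.keys (m + n). c x ^ Poly_Mapping.lookup (m + n) x) =
    (\<Prod>x\<in>Poly_Mapping.keys m. c x ^ Poly_Mapping.lookup m x) *
    (\<Prod>x\<in>Poly_Mapping.keys n. (c x :: complex) ^ Poly_Mapping.lookup n x)"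
proof -
  define S where "S = Poly_Mapping.keys m \<union> Poly_Mapping.keys n"
  have *: "(\<Prod>x\<in>Poly_Mapping.keys l. c x ^ Poly_Mapping.lookup l x) = (\<Prod>x\<in>S. c x ^ Poly_Mapping.lookup l x)"
    if "Poly_Mapping.keys l \<subseteq> S" for l :: "'x \<Rightarrow>\<^sub>0 nat"
    using that by (intro prod.mono_neutral_left) (auto simp: S_def in_keys_iff)
  have "Poly_Mapping.keys (m + n) \<subseteq> S" using keys_add[of m n] by (simp add: S_def)
  then show ?thesis
    using *[of m] *[of n] *[of "m + n"] by (simp add: S_def lookup_add power_add prod.distrib)
qed

lemma sum_single: "(\<Sum>m\<in>Poly_Mapping.keys p. Poly_Mapping.single m (Poly_Mapping.lookup p m)) = p"
proof (rule poly_mapping_eqI)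
  fix n
  show "Poly_Mapping.lookup (\<Sum>m\<in>Poly_Mapping.keys p. Poly_Mapping.single m (Poly_Mapping.lookup p m)) n =
      Poly_Mapping.lookup p n"
    by (simp add: lookup_sum lookup_single when_def in_keys_iff)
qed

lemma mpoly_eval_mult: "mpoly_eval (p * q) c = mpoly_eval p c * mpoly_eval q c"
proof -
  define sp where "sp m = Poly_Mapping.single m (Poly_Mapping.lookup p m)" for m
  define sq where "sq m = Poly_Mapping.single m (Poly_Mapping.lookup q m)" for m
  have single: "mpoly_eval (sp m * sq n) c = mpoly_eval (sp m) c * mpoly_eval (sq n) c" for m n
    by (simp add: sp_def sq_def mult_single mpoly_eval_single monomial_eval_add)
  have "p * q = (\<Sum>m\<in>Poly_Mapping.keys p. sp m) * (\<Sum>n\<in>Poly_Mapping.keys q. sq n)"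
    by (simp only: sp_def sq_def sum_single)
  also have "mpoly_eval \<dots> c =
      mpoly_eval (\<Sum>m\<in>Poly_Mapping.keys p. sp m) c * mpoly_eval (\<Sum>n\<in>Poly_Mapping.keys q. sq n) c"
    by (simp only: sum_product mpoly_eval_sum single)
  finally show ?thesis by (simp only: sp_def sq_def sum_single)
qed

lemma polyfun_mpoly_eval: "p \<in> polys_in A \<Longrightarrow> mpoly_eval p \<in> polyfun A"
  unfolding mpoly_eval_def polys_in_def
  by (intro polyfun_sum polyfun_mult polyfun_const polyfun_prod polyfun_power polyfun_var) auto

lemma polyfun_imp_mpoly: "f \<in> polyfun A \<Longrightarrow> \<exists>p\<in>polys_in A. f = mpoly_eval p"
proof (induction rule: polyfun.induct)
  case (polyfun_const k)
  show ?case
    by (rule bexI[of _ "Poly_Mapping.single 0 k"]) (auto simp: polys_in_def mpoly_eval_single)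
next
  case (polyfun_var a)
  then show ?case
    by (intro bexI[of _ "Poly_Mapping.single (Poly_Mapping.single a 1) 1"])
      (auto simp: polys_in_def mpoly_eval_single)
next
  case (polyfun_add f g)
  then obtain p q where "p \<in> polys_in A" "q \<in> polys_in A" "f = mpoly_eval p" "g = mpoly_eval q" by blast
  moreover have "p + q \<in> polys_in A" if "p \<in> polys_in A" "q \<in> polys_in A" for p q
    using that keys_add[of p q] unfolding polys_in_def by blast
  ultimately show ?case by (intro bexI[of _ "p + q"]) (auto simp: mpoly_eval_add)
next
  case (polyfun_mult f g)
  then obtain p q where pq: "p \<in> polys_in A" "q \<in> polys_in A" "f = mpoly_eval p" "g = mpoly_eval q" by blast
  have "p * q \<in> polys_in A"
    unfolding polys_in_def
  proof (intro CollectI ballI)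
    fix l assume "l \<in> Poly_Mapping.keys (p * q)"
    then obtain m n where "m \<in> Poly_Mapping.keys p" "n \<in> Poly_Mapping.keys q" "l = m + n"
      using keys_mult[of p q] by blast
    then show "Poly_Mapping.keys l \<subseteq> A" using pq(1,2) keys_add[of m n] unfolding polys_in_def by blast
  qed
  then show ?case using pq by (intro bexI[of _ "p * q"]) (auto simp: mpoly_eval_mult)
qed

section \<open>Differentials of Laurent polynomials on the torus\<close>

definition torus_monomial :: "complex ^ 'k::finite \<Rightarrow> int ^ 'k \<Rightarrow> complex" where
  "torus_monomial y a = (\<Prod>i\<in>UNIV. (y $ i) powi (a $ i))"

text \<open>The logarithmic form of the differential: the factors of \<open>h $ i / y $ i\<close>
  become the sums in \<open>affine_relations\<close>.\<close>

lemma laurent_eval_has_derivative: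
  fixes y :: "complex ^ 'k::finite"
  assumes "y \<in> torus"
  shows "(laurent_eval \<phi> has_derivative (\<lambda>h. \<Sum>i\<in>UNIV. h $ i / y $ i *
    (\<Sum>a\<in>Poly_Mapping.keys \<phi>. Poly_Mapping.lookup \<phi> a * torus_monomial y a * of_int (a $ i)))) (at y)"
proof -
  have y: "y $ i \<noteq> 0" for i using assms by (simp add: torus_def)
  have "((\<lambda>y. \<Prod>i\<in>UNIV. (y $ i) powi (a $ i)) has_derivative
      (\<lambda>h. \<Sum>i\<in>UNIV. h $ i / y $ i * (torus_monomial y a * of_int (a $ i)))) (at y)" for a :: "int ^ 'k"
  proof -
    have "((\<lambda>y. (y $ i) powi (a $ i)) has_derivative
        (\<lambda>h. h $ i * (of_int (a $ i) * (y $ i) powi (a $ i - 1)))) (at y)" for i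
      by (rule has_derivative_power_int[where f = "\<lambda>y. y $ i" and x = y, OF y])
        (rule bounded_linear.has_derivative[OF bounded_linear_vec_nth has_derivative_ident])
    then have "((\<lambda>y. \<Prod>i\<in>UNIV. (y $ i) powi (a $ i)) has_derivative
      (\<lambda>h. \<Sum>i\<in>UNIV. h $ i * (of_int (a $ i) * (y $ i) powi (a $ i - 1)) *
        (\<Prod>j\<in>UNIV - {i}. (y $ j) powi (a $ j)))) (at y)"
      by (rule has_derivative_prod)
    moreover have "h $ i * (of_int (a $ i) * (y $ i) powi (a $ i - 1)) *
        (\<Prod>j\<in>UNIV - {i}. (y $ j) powi (a $ j)) = h $ i / y $ i * (torus_monomial y a * of_int (a $ i))"
      for h :: "complex ^ 'k" and i
    proof -
      have "torus_monomial y a = (y $ i) powi (a $ i) * (\<Prod>j\<in>UNIV - {i}. (y $ j) powi (a $ j))"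
        unfolding torus_monomial_def by (rule prod.remove) auto
      then show ?thesis by (simp add: power_int_diff y)
    qed
    ultimately show ?thesis by simp
  qed
  then have "(laurent_eval \<phi> has_derivative (\<lambda>h. \<Sum>a\<in>Poly_Mapping.keys \<phi>. Poly_Mapping.lookup \<phi> a *
      (\<Sum>i\<in>UNIV. h $ i / y $ i * (torus_monomial y a * of_int (a $ i))))) (at y)"
    unfolding laurent_eval_def[abs_def] by (intro has_derivative_sum has_derivative_mult_right)
  moreover have "(\<Sum>a\<in>Poly_Mapping.keys \<phi>. Poly_Mapping.lookup \<phi> a *
      (\<Sum>i\<in>UNIV. h $ i / y $ i * (torus_monomial y a * of_int (a $ i)))) =
    (\<Sum>i\<in>UNIV. h $ i / y $ i *
      (\<Sum>a\<in>Poly_Mapping.keys \<phi>. Poly_Mapping.lookup \<phi> a * torus_monomial y a * of_int (a $ i)))" for h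
    unfolding sum_distrib_left by (subst sum.swap) (simp add: mult_ac)
  ultimately show ?thesis by simp
qed

lemma singular_at_iff:
  assumes fin: "finite A" and \<phi>: "\<phi> \<in> laurent_space A" and y: "y \<in> torus"
  shows "laurent_eval \<phi> y = 0 \<and> (laurent_eval \<phi> has_derivative (\<lambda>_. 0)) (at y) \<longleftrightarrow>
    (\<lambda>a. Poly_Mapping.lookup \<phi> a * torus_monomial y a) \<in> affine_relations A"
proof -
  define S where "S i = (\<Sum>a\<in>Poly_Mapping.keys \<phi>. Poly_Mapping.lookup \<phi> a * torus_monomial y a * of_int (a $ i))" for i
  have D: "(laurent_eval \<phi> has_derivative (\<lambda>h. \<Sum>i\<in>UNIV. h $ i / y $ i * S i)) (at y)"
    unfolding S_def by (rule laurent_eval_has_derivative[OF y])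
  have sup: "(\<Sum>a\<in>Poly_Mapping.keys \<phi>. Poly_Mapping.lookup \<phi> a * t a) = (\<Sum>a\<in>A. Poly_Mapping.lookup \<phi> a * t a)" for t
    using \<phi> fin by (intro sum.mono_neutral_left) (auto simp: laurent_space_def in_keys_iff)
  have eval: "laurent_eval \<phi> y = (\<Sum>a\<in>A. Poly_Mapping.lookup \<phi> a * torus_monomial y a)"
    unfolding laurent_eval_def sup torus_monomial_def ..
  have S: "S i = (\<Sum>a\<in>A. Poly_Mapping.lookup \<phi> a * torus_monomial y a * of_int (a $ i))" for i
    unfolding S_def mult.assoc sup ..
  have "(laurent_eval \<phi> has_derivative (\<lambda>_. 0)) (at y) \<longleftrightarrow> (\<forall>i. S i = 0)"
  proof
    assume "(laurent_eval \<phi> has_derivative (\<lambda>_. 0)) (at y)"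
    then have eq: "(\<lambda>h. \<Sum>i\<in>UNIV. h $ i / y $ i * S i) = (\<lambda>_. 0)" by (rule has_derivative_unique[OF D])
    show "\<forall>i. S i = 0"
    proof
      fix j
      \<comment> \<open>The length \<open>y $ j\<close> of the test vector cancels the
        denominator.\<close>
      have "(\<Sum>i\<in>UNIV. axis j (y $ j) $ i / y $ i * S i) = 0" using fun_cong[OF eq] .
      moreover have "(\<Sum>i\<in>UNIV. axis j (y $ j) $ i / y $ i * S i) = (\<Sum>i\<in>UNIV. if i = j then S i else 0)"
        using y by (intro sum.cong) (auto simp: axis_def torus_def)
      ultimately show "S j = 0" by simp
    qed
  next
    assume "\<forall>i. S i = 0"
    then show "(laurent_eval \<phi> has_derivative (\<lambda>_. 0)) (at y)" using D by simp
  qed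
  then show ?thesis by (simp add: eval S affine_relations_def)
qed

lemma torus_monomial_exp: "torus_monomial (\<chi> i. exp (x i)) a = exp (pair a x)"
  by (simp add: torus_monomial_def pair_def exp_sum exp_power_int)

text \<open>Nonzero complex numbers have logarithms, so exponential coordinates reach every point of
  the torus.\<close>

lemma lookup_Sigma_set:
  assumes fin: "finite A" and \<phi>: "\<phi> \<in> Sigma_set A"
  shows "Poly_Mapping.lookup \<phi> \<in> singular_points A"
proof -
  obtain y where y: "y \<in> torus" "\<phi> \<in> laurent_space A" "laurent_eval \<phi> y = 0"
    "(laurent_eval \<phi> has_derivative (\<lambda>_. 0)) (at y)" using \<phi> by (auto simp: Sigma_set_def)
  define w where "w a = Poly_Mapping.lookup \<phi> a * torus_monomial y a" for a
  have w: "w \<in> affine_relations A" unfolding w_def using singular_at_iff[OF fin y(2,1)] y(3,4) by blast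
  define x where "x i = Ln (y $ i)" for i
  have "y = (\<chi> i. exp (x i))" using y(1) by (simp add: vec_eq_iff x_def torus_def)
  then have "torus_monomial y a = exp (pair a x)" for a using torus_monomial_exp by metis
  moreover have "pair a (\<lambda>i. - x i) = - pair a x" for a by (simp add: pair_def sum_negf)
  ultimately have "torus_act w (\<lambda>i. - x i) = Poly_Mapping.lookup \<phi>"
    by (simp add: torus_act_def w_def fun_eq_iff exp_minus)
  then show ?thesis using torus_act_in_singular[OF w] by metis
qed

text \<open>Relations constrain values on \<open>A\<close> only and are arbitrary elsewhere; the
  Laurent polynomial is cut off to zero outside \<open>A\<close>.\<close>

lemma singular_points_Sigma_set:
  assumes fin: "finite A" and z: "z \<in> singular_points A"
  obtains \<phi> where "\<phi> \<in> Sigma_set A" "\<And>a. a \<in> A \<Longrightarrow> Poly_Mapping.lookup \<phi> a = z a"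
proof -
  obtain w x where w: "w \<in> affine_relations A" and zw: "z = torus_act w x"
    using z by (auto simp: singular_points_def)
  define \<phi> where "\<phi> = Abs_poly_mapping (\<lambda>a. if a \<in> A then z a else 0)"
  have lookup: "Poly_Mapping.lookup \<phi> = (\<lambda>a. if a \<in> A then z a else 0)"
    unfolding \<phi>_def by (rule lookup_Abs_poly_mapping) (use fin in simp)
  have \<phi>: "\<phi> \<in> laurent_space A" by (auto simp: laurent_space_def in_keys_iff lookup split: if_splits)
  define y :: "complex ^ 'a" where "y = (\<chi> i. exp (- x i))"
  have y: "y \<in> torus" by (simp add: torus_def y_def)
  have "torus_monomial y a = exp (- pair a x)" for a
    unfolding y_def torus_monomial_exp by (simp add: pair_def sum_negf)
  then have "Poly_Mapping.lookup \<phi> a * torus_monomial y a = w a" if "a \<in> A" for a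
    using that by (simp add: lookup zw torus_act_def exp_minus)
  then have "(\<lambda>a. Poly_Mapping.lookup \<phi> a * torus_monomial y a) \<in> affine_relations A"
    using w by (simp add: affine_relations_def)
  then have "\<phi> \<in> Sigma_set A" using singular_at_iff[OF fin \<phi> y] \<phi> y by (auto simp: Sigma_set_def)
  then show ?thesis using that by (simp add: lookup)
qed

theorem proposition2p14:
  fixes A :: "(int ^ 'k::finite) set"
  assumes "finite A"
    and "\<not> (\<exists>H1 H2. affine_hyperplane H1 \<and> affine_hyperplane H2 \<and>
            affine_parallel H1 H2 \<and> real_point ` A \<subseteq> H1 \<union> H2)"
  shows "\<not> dual_defect A"
proof -
  interpret not_in_two_hyperplanes A by unfold_locales (fact assms)+
  obtain f where f: "f \<in> discriminant_ideal" "f \<noteq> 0"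
    "\<And>q. q \<in> discriminant_ideal \<Longrightarrow> \<exists>s. q = f * s"
    using ideal_principal by blast
  have "f \<in> polyfun A" using f(1) by (simp add: discriminant_ideal_def)
  then obtain p where p: "p \<in> polys_in A" "f = mpoly_eval p" using polyfun_imp_mpoly by blast
  have vanish_iff: "Sigma_set A \<subseteq> zero_locus A q \<longleftrightarrow> mpoly_eval q \<in> discriminant_ideal"
    if q: "q \<in> polys_in A" for q
  proof
    assume *: "Sigma_set A \<subseteq> zero_locus A q"
    have "mpoly_eval q z = 0" if "z \<in> singular_points A" for z
    proof -
      obtain \<phi> where \<phi>: "\<phi> \<in> Sigma_set A" "\<And>a. a \<in> A \<Longrightarrow> Poly_Mapping.lookup \<phi> a = z a"
        using singular_points_Sigma_set[OF fin \<open>z \<in> singular_points A\<close>] by blast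
      have "mpoly_eval q (Poly_Mapping.lookup \<phi>) = 0" using * \<phi>(1) by (auto simp: zero_locus_def)
      moreover have "mpoly_eval q (Poly_Mapping.lookup \<phi>) = mpoly_eval q z"
        by (rule polyfun_cong[OF polyfun_mpoly_eval[OF q] \<phi>(2)])
      ultimately show ?thesis by simp
    qed
    then show "mpoly_eval q \<in> discriminant_ideal"
      using polyfun_mpoly_eval[OF q] by (simp add: discriminant_ideal_def)
  next
    assume "mpoly_eval q \<in> discriminant_ideal"
    then show "Sigma_set A \<subseteq> zero_locus A q"
      using lookup_Sigma_set[OF fin]
      by (auto simp: zero_locus_def discriminant_ideal_def Sigma_set_def)
  qed
  have "zariski_closure A (Sigma_set A) = zero_locus A p"
  proof (intro set_eqI iffI)
    fix \<phi> assume "\<phi> \<in> zariski_closure A (Sigma_set A)"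
    then show "\<phi> \<in> zero_locus A p"
      using vanish_iff[OF p(1)] p f(1) by (auto simp: zariski_closure_def)
  next
    fix \<phi> assume \<phi>: "\<phi> \<in> zero_locus A p"
    have "\<phi> \<in> zero_locus A q" if q: "q \<in> polys_in A" "Sigma_set A \<subseteq> zero_locus A q" for q
    proof -
      have "mpoly_eval q \<in> discriminant_ideal" using vanish_iff q by blast
      then obtain s where "mpoly_eval q = f * s" using f(3) by blast
      then show ?thesis using \<phi> p(2) by (simp add: zero_locus_def)
    qed
    then show "\<phi> \<in> zariski_closure A (Sigma_set A)"
      using \<phi> by (simp add: zariski_closure_def zero_locus_def)
  qed
  moreover have "\<exists>m\<in>Poly_Mapping.keys p. m \<noteq> 0"
  proof (rule ccontr)
    \<comment> \<open>The origin is a singular point, so \<open>f\<close> vanishes there, and a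
      constant \<open>f\<close> would be zero.\<close>
    assume "\<not> ?thesis"
    then have "mpoly_eval p c = mpoly_eval p (\<lambda>_. 0)" for c
      unfolding mpoly_eval_def by (intro sum.cong) auto
    moreover have "torus_act (\<lambda>_. 0) (\<lambda>_. 0) \<in> singular_points A"
      by (rule torus_act_in_singular) (simp add: affine_relations_def)
    then have "f (\<lambda>_. 0) = 0" using f(1) by (simp add: discriminant_ideal_def torus_act_def)
    ultimately have "f = 0" using p(2) by (auto simp: fun_eq_iff)
    then show False using f(2) by blast
  qed
  ultimately show ?thesis using p(1) by (auto simp: dual_defect_def hypersurface_def)
qed

end
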